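(* Let $n\in\mathbb{N}$. Then: (i) There is a rooted tree $S_n$ with at most $n^{2.318}$ vertices that is an NCA-universal tree for the family $\mathcal{T}_n$ of (unlabeled) rooted trees with $n$ vertices. (ii) There is a rooted tree $S_n^{bin}$ with at most $n^{1.894}$ vertices that is an NCA-universal tree for the family $\mathcal{B}_n$ of (unlabeled) rooted binary trees with $n$ vertices.
   Context: In a rooted tree $T$, a vertex $u$ is an ancestor of $v$ if $u$ lies on the unique path from $v$ to the root (so $u$ is an ancestor of itself). The nearest common ancestor $\mathrm{nca}_T(u,v)$ is the common ancestor of $u$ and $v$ furthest from the root. A rooted binary tree is a rooted tree in which every vertex has at most two children. A rooted tree $S$ is an NCA-universal tree for a family $\mathcal{T}$ of rooted trees if for every $T\in\mathcal{T}$ there is an injective map $\varphi_T:V(T)\to V(S)$ with $\varphi_T(\mathrm{nca}_T(u,v))=\mathrm{nca}_S(\varphi_T(u),\varphi_T(v))$ for all $u,v\in V(T)$; the root of $T$ need not be mapped to the root of $S$. The size of a tree is its number of vertices. *)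

theory Defs
  imports Complex_Main "Graph_Theory.Graph_Theory"
begin

text \<open>A finite simple undirected graph is a symmetric loop-free digraph without parallel
  arcs (locale \<^locale>\<open>pair_graph\<close>); a rooted graph is such a graph paired with a vertex.\<close>

type_synonym 'a rooted_graph = "'a pair_pre_digraph \<times> 'a"

abbreviation rverts :: "'a rooted_graph \<Rightarrow> 'a set" where
  "rverts T \<equiv> pverts (fst T)"

definition path_from_to :: "'a rooted_graph \<Rightarrow> 'a \<Rightarrow> 'a list \<Rightarrow> 'a \<Rightarrow> bool" where
  "path_from_to T u p v \<longleftrightarrow> vpath p (with_proj (fst T)) \<and> hd p = u \<and> last p = v"

text \<open>The constant \<^const>\<open>tree\<close> of the library only excludes directed cycles: it accepts
  orientations of graphs with undirected cycles, and rejects symmetric digraphs with an arc,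
  since \<open>u, v, u\<close> is a directed cycle.  Hence trees are defined here by uniqueness of paths.\<close>

definition rooted_tree :: "'a rooted_graph \<Rightarrow> bool" where
  "rooted_tree T \<longleftrightarrow> pair_graph (fst T) \<and> snd T \<in> rverts T \<and>
     (\<forall>u\<in>rverts T. \<forall>v\<in>rverts T. \<exists>!p. path_from_to T u p v)"

definition path_to_root :: "'a rooted_graph \<Rightarrow> 'a \<Rightarrow> 'a list" where
  "path_to_root T v = (THE p. path_from_to T v p (snd T))"

definition ancestor :: "'a rooted_graph \<Rightarrow> 'a \<Rightarrow> 'a \<Rightarrow> bool" where
  "ancestor T u v \<longleftrightarrow> v \<in> rverts T \<and> u \<in> set (path_to_root T v)"

definition depth :: "'a rooted_graph \<Rightarrow> 'a \<Rightarrow> nat" where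
  "depth T v = vwalk_length (path_to_root T v)"

definition nca :: "'a rooted_graph \<Rightarrow> 'a \<Rightarrow> 'a \<Rightarrow> 'a" where
  "nca T u v = (ARG_MAX (depth T) w. ancestor T w u \<and> ancestor T w v)"

definition children :: "'a rooted_graph \<Rightarrow> 'a \<Rightarrow> 'a set" where
  "children T v = {w. (v, w) \<in> parcs (fst T) \<and> ancestor T v w}"

definition rooted_binary_tree :: "'a rooted_graph \<Rightarrow> bool" where
  "rooted_binary_tree T \<longleftrightarrow> rooted_tree T \<and> (\<forall>v\<in>rverts T. card (children T v) \<le> 2)"

definition nca_universal_tree :: "'b rooted_graph \<Rightarrow> 'a rooted_graph set \<Rightarrow> bool" where
  "nca_universal_tree S F \<longleftrightarrow> rooted_tree S \<and>
     (\<forall>T\<in>F. \<exists>\<phi>. inj_on \<phi> (rverts T) \<and> \<phi> ` rverts T \<subseteq> rverts S \<and>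
        (\<forall>u\<in>rverts T. \<forall>v\<in>rverts T. \<phi> (nca T u v) = nca S (\<phi> u) (\<phi> v)))"

text \<open>Every finite rooted tree is isomorphic to one whose vertices are natural numbers, so at
  vertex type \<^typ>\<open>nat\<close> the two families below contain a representative of every
  isomorphism class of (unlabeled) rooted trees with \<open>n\<close> vertices.\<close>

definition rooted_trees :: "nat \<Rightarrow> 'a rooted_graph set" where
  "rooted_trees n = {T. rooted_tree T \<and> card (rverts T) = n}"

definition rooted_binary_trees :: "nat \<Rightarrow> 'a rooted_graph set" where
  "rooted_binary_trees n = {T. rooted_binary_tree T \<and> card (rverts T) = n}"

end

theory Submission
  imports Defs "HOL-Library.Sublist" "HOL-Library.Countable"
begin

text \<open>Fix \<open>\<lambda>\<close>. A tree \<open>T\<close> with \<open>n\<close> vertices has a vertex \<open>v\<close> whose subtree has at least \<open>\<lambda> n\<close> vertices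
  while the subtrees of its children have fewer. The part of \<open>T\<close> outside this subtree has at most
  \<open>m = (1 - \<lambda>) n\<close> vertices; it consists of the path from the root to \<open>v\<close> with trees hanging off it.
  Such a path embeds in a universal spine \<open>B m\<close>: cutting it where the accumulated size passes \<open>m / 2\<close>
  leaves one path vertex between two paths of size at most \<open>m / 2\<close>, so \<open>B m\<close> is \<open>B (m / 2)\<close>, one vertex
  with hanging universal trees, \<open>B (m / 2)\<close>. At \<open>v\<close>, and at every path vertex, the \<open>i\<close>-th
  largest of child subtrees of total size \<open>k\<close> has size at most \<open>k / i\<close>, so universal trees for the sizes
  \<open>k div i\<close> suffice; below \<open>v\<close> the first of them is replaced by one for \<open>\<lambda> n\<close>. The size bound \<open>n powr c\<close>
  then follows by induction as soon as
  \<open>\<lambda> powr c + (\<zeta> - 1) + \<zeta> * (1 - \<lambda>) powr c / (1 - 2 powr (1 - c)) \<le> 1\<close> with \<open>\<zeta> = (\<Sum>i\<ge>1. i powr (- c))\<close>.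
  For binary trees a path vertex carries only one hanging tree and \<open>v\<close> has two children, so that
  \<open>\<zeta> - 1\<close> becomes \<open>2 powr (- c)\<close> and the factor \<open>\<zeta>\<close> becomes \<open>1\<close>. The exponents are just large enough for
  \<open>\<lambda> = 33/50\<close> and \<open>\<lambda> = 7/10\<close>.\<close>

section \<open>Topological minors of ordered trees\<close>

datatype rose = Node "rose list"

primrec nodes :: "rose \<Rightarrow> nat" where
  "nodes (Node ts) = Suc (sum_list (map nodes ts))"

text \<open>The tree below \<open>v\<close>, given by its child function \<open>ch\<close>, embeds in an ordered tree such that
  distinct children go to distinct branches.\<close>

inductive topo_minor :: "('a \<Rightarrow> 'a set) \<Rightarrow> 'a \<Rightarrow> rose \<Rightarrow> bool" for ch where
  node: "\<lbrakk>distinct cs; set cs = ch v; length cs \<le> length ts;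
     \<forall>i<length cs. topo_minor ch (cs ! i) (ts ! i)\<rbrakk> \<Longrightarrow> topo_minor ch v (Node ts)"
| below: "\<lbrakk>t \<in> set ts; topo_minor ch v t\<rbrakk> \<Longrightarrow> topo_minor ch v (Node ts)"

text \<open>The equation for \<open>sz\<close> makes sizes drop strictly from a vertex to its
  children, so every branch is finite and induction on \<open>sz\<close> is available.\<close>

definition sized_tree :: "nat \<Rightarrow> ('a \<Rightarrow> 'a set) \<Rightarrow> ('a \<Rightarrow> nat) \<Rightarrow> bool" where
  "sized_tree d ch sz \<longleftrightarrow>
     (\<forall>v. finite (ch v) \<and> card (ch v) \<le> d \<and> sz v = Suc (\<Sum>c\<in>ch v. sz c))"

abbreviation descendant :: "('a \<Rightarrow> 'a set) \<Rightarrow> 'a \<Rightarrow> 'a \<Rightarrow> bool" where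
  "descendant ch \<equiv> (\<lambda>u v. v \<in> ch u)\<^sup>*\<^sup>*"

text \<open>The bound \<open>sz v \<le> n\<close>, instead of equality, lets one tree receive all
  subtrees up to a given size. The vertex type is fixed to \<open>nat\<close> because a formula
  cannot quantify over types.\<close>

definition universal :: "nat \<Rightarrow> nat \<Rightarrow> rose \<Rightarrow> bool" where
  "universal d n t \<longleftrightarrow> (\<forall>(ch :: nat \<Rightarrow> nat set) sz v.
     sized_tree d ch sz \<longrightarrow> sz v \<le> n \<longrightarrow> topo_minor ch v t)"

lemma universalD:
  "\<lbrakk>universal d n t; sized_tree d ch sz; sz v \<le> n\<rbrakk> \<Longrightarrow> topo_minor ch v t"
  for ch :: "nat \<Rightarrow> nat set"
  unfolding universal_def by blast

lemma sized_treeD: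
  assumes "sized_tree d ch sz"
  shows "finite (ch v)" "card (ch v) \<le> d" "sz v = Suc (\<Sum>c\<in>ch v. sz c)" "sz v > 0"
proof -
  show "finite (ch v)" "card (ch v) \<le> d" "sz v = Suc (\<Sum>c\<in>ch v. sz c)"
    using assms unfolding sized_tree_def by blast+
  then show "sz v > 0" by linarith
qed

section \<open>Sizes along descending paths and among siblings\<close>

lemma child_size_less:
  assumes "sized_tree d ch sz" "c \<in> ch v"
  shows "sz c < sz v"
proof -
  have "sz c \<le> (\<Sum>c\<in>ch v. sz c)"
    by (rule member_le_sum) (use assms sized_treeD(1)[OF assms(1)] in auto)
  then show ?thesis using sized_treeD(3)[OF assms(1), of v] by linarith
qed

lemma descendant_size_le:
  assumes "sized_tree d ch sz" "descendant ch u v"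
  shows "sz v \<le> sz u"
  using assms(2)
proof (induction rule: rtranclp_induct)
  case (step y z)
  then show ?case using child_size_less[OF assms(1), of z y] by linarith
qed simp

text \<open>On the way from \<open>u\<close> to \<open>v\<close>, the step from \<open>x\<close> to
  \<open>x'\<close> is the one at which the size lost since \<open>u\<close> first exceeds
  \<open>h\<close>; a spine is cut at \<open>x\<close>.\<close>

lemma descendant_crossing:
  assumes "sized_tree d ch sz" "descendant ch u v" "sz v + h < sz u"
  shows "\<exists>x x'. descendant ch u x \<and> x' \<in> ch x \<and> descendant ch x' v \<and>
    sz u \<le> sz x + h \<and> sz x' + h < sz u"
  using assms(2,3)
proof (induction rule: rtranclp_induct)
  case (step v w)
  show ?case
  proof (cases "sz v + h < sz u")
    case True
    then obtain x x' where "descendant ch u x" "x' \<in> ch x" "descendant ch x' v"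
      "sz u \<le> sz x + h" "sz x' + h < sz u" using step by blast
    moreover have "descendant ch x' w"
      using \<open>descendant ch x' v\<close> step(2) by (rule rtranclp.rtrancl_into_rtrancl)
    ultimately show ?thesis by blast
  next
    case False
    then show ?thesis using step by (meson not_less rtranclp.rtrancl_refl)
  qed
qed simp

text \<open>In decreasing order, the elements at positions \<open>0\<close> to \<open>i\<close> are
  \<open>i + 1\<close> many, each at least as large as the one at position \<open>i\<close>.\<close>

lemma obtain_sorted_by_size:
  fixes sz :: "'a \<Rightarrow> nat"
  assumes "finite A"
  obtains cs where "distinct cs" "set cs = A"
    "\<And>i. i < length cs \<Longrightarrow> Suc i * sz (cs ! i) \<le> (\<Sum>c\<in>A. sz c)"
proof -
  obtain bs where bs: "distinct bs" "set bs = A"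
    using finite_distinct_list[OF assms] by blast
  define cs where "cs = rev (sort_key sz bs)"
  have cs: "distinct cs" "set cs = A" using bs by (auto simp: cs_def)
  have desc: "sz (cs ! i) \<le> sz (cs ! j)" if "j \<le> i" "i < length cs" for i j
  proof -
    have "sorted (rev (map sz cs))" by (simp add: cs_def flip: rev_map)
    from sorted_rev_nth_mono[OF this that(1)] that show ?thesis by simp
  qed
  have "Suc i * sz (cs ! i) \<le> (\<Sum>c\<in>A. sz c)" if i: "i < length cs" for i
  proof -
    have "Suc i * sz (cs ! i) = (\<Sum>j\<in>{..i}. sz (cs ! i))" by simp
    also have "\<dots> \<le> (\<Sum>j\<in>{..i}. sz (cs ! j))"
      by (rule sum_mono) (use desc i in auto)
    also have "\<dots> \<le> (\<Sum>j\<in>{..<length cs}. sz (cs ! j))"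
      by (rule sum_mono2) (use i in auto)
    also have "\<dots> = (\<Sum>c\<in>A. sz c)"
      using sum.distinct_set_conv_list[OF cs(1), of sz]
      by (simp add: cs(2) sum_list_sum_nth atLeast0LessThan)
    finally show ?thesis .
  qed
  with cs that show ?thesis by blast
qed

text \<open>Branches for children in order of decreasing size. The cap \<open>min d k\<close> keeps
  \<open>k div i\<close> positive; starting at \<open>a = 2\<close> leaves out the branch of the
  largest child.\<close>

definition hanging :: "(nat \<Rightarrow> rose) \<Rightarrow> nat \<Rightarrow> nat \<Rightarrow> nat \<Rightarrow> rose list" where
  "hanging F a d k = map (\<lambda>i. F (k div i)) [a..<Suc (min d k)]"

text \<open>Sizes are positive, so \<open>A\<close> has at most \<open>k\<close> elements; sorted by
  decreasing size, the one at position \<open>i\<close> has size at most \<open>k div Suc i\<close>,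
  which is what the branch at that position is made for.\<close>

lemma children_in_hanging:
  fixes ch :: "nat \<Rightarrow> nat set"
  assumes T: "sized_tree d ch sz"
    and F: "\<And>j. 0 < j \<Longrightarrow> j \<le> k \<Longrightarrow> universal d j (F j)"
    and A: "finite A" "card A \<le> e" "(\<Sum>c\<in>A. sz c) \<le> k"
  obtains cs where "distinct cs" "set cs = A" "length cs \<le> length (hanging F 1 e k)"
    "\<And>i. i < length cs \<Longrightarrow> topo_minor ch (cs ! i) (hanging F 1 e k ! i)"
proof -
  obtain cs where cs: "distinct cs" "set cs = A"
    "\<And>i. i < length cs \<Longrightarrow> Suc i * sz (cs ! i) \<le> (\<Sum>c\<in>A. sz c)"
    using obtain_sorted_by_size[OF A(1), of sz] by blast
  have "card A \<le> (\<Sum>c\<in>A. sz c)"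
    using sum_mono[of A "\<lambda>_. 1" sz] sized_treeD(4)[OF T] by (simp add: Suc_leI)
  then have len: "length cs \<le> min e k"
    using A cs distinct_card by fastforce
  have "topo_minor ch (cs ! i) (hanging F 1 e k ! i)" if i: "i < length cs" for i
  proof -
    have "Suc i * sz (cs ! i) \<le> k" using cs(3)[OF i] A(3) by linarith
    then have le: "sz (cs ! i) \<le> k div Suc i"
      by (metis div_le_mono nonzero_mult_div_cancel_left nat.distinct(1))
    have "0 < k div Suc i" using le sized_treeD(4)[OF T, of "cs ! i"] by linarith
    then have "topo_minor ch (cs ! i) (F (k div Suc i))"
      by (intro universalD[OF F T le]) auto
    moreover have "hanging F 1 e k ! i = F (k div Suc i)"
      unfolding hanging_def using i len by (subst nth_map) (auto simp del: upt_Suc)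
    ultimately show ?thesis by simp
  qed
  moreover have "length cs \<le> length (hanging F 1 e k)" using len by (simp add: hanging_def del: upt_Suc)
  ultimately show ?thesis using that cs by blast
qed

lemma nodes_hanging:
  fixes c :: real
  assumes a: "0 < a" and F: "\<And>j. 0 < j \<Longrightarrow> j \<le> k \<Longrightarrow> real (nodes (F j)) \<le> real j powr c"
  shows "real (sum_list (map nodes (hanging F a d k))) \<le> (\<Sum>i=a..d. real (k div i) powr c)"
proof -
  have "real (sum_list (map nodes (hanging F a d k))) = (\<Sum>i=a..min d k. real (nodes (F (k div i))))"
    unfolding hanging_def
    by (simp add: comp_def interv_sum_list_conv_sum_set_nat atLeastLessThanSuc_atLeastAtMost
      del: upt_Suc)
  also have "\<dots> \<le> (\<Sum>i=a..min d k. real (k div i) powr c)"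
    by (rule sum_mono, rule F) (use a in \<open>auto simp: div_greater_zero_iff\<close>)
  also have "\<dots> \<le> (\<Sum>i=a..d. real (k div i) powr c)"
    by (rule sum_mono2) auto
  finally show ?thesis .
qed

section \<open>Rooted graphs as trees\<close>

lemma path_from_to_iff:
  "path_from_to T u p v \<longleftrightarrow> p \<noteq> [] \<and> distinct p \<and> set p \<subseteq> rverts T \<and>
     successively (\<lambda>a b. (a, b) \<in> parcs (fst T)) p \<and> hd p = u \<and> last p = v"
proof -
  have "set (vwalk_arcs p) \<subseteq> parcs (fst T) \<longleftrightarrow> successively (\<lambda>a b. (a, b) \<in> parcs (fst T)) p"
    by (induction p rule: vwalk_arcs.induct) auto
  then show ?thesis unfolding path_from_to_def vpath_def vwalk_def by auto
qed

lemma rooted_treeD: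
  assumes "rooted_tree T"
  shows "pair_graph (fst T)" "finite (rverts T)" "snd T \<in> rverts T"
    "(a, b) \<in> parcs (fst T) \<Longrightarrow> a \<in> rverts T \<and> b \<in> rverts T \<and> a \<noteq> b \<and> (b, a) \<in> parcs (fst T)"
    "\<lbrakk>path_from_to T u p v; path_from_to T u q v\<rbrakk> \<Longrightarrow> p = q"
proof -
  show G: "pair_graph (fst T)" and "snd T \<in> rverts T"
    using assms unfolding rooted_tree_def by auto
  interpret pair_graph "fst T" by (rule G)
  show "finite (rverts T)" by (rule pair_finite_verts)
  show "a \<in> rverts T \<and> b \<in> rverts T \<and> a \<noteq> b \<and> (b, a) \<in> parcs (fst T)"
    if "(a, b) \<in> parcs (fst T)"
    using in_arcsD1[OF that] in_arcsD2[OF that] pair_no_loops[OF that] arcs_symmetric[OF that] by simp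
  show "p = q" if pq: "path_from_to T u p v" "path_from_to T u q v"
  proof -
    have "u \<in> rverts T" "v \<in> rverts T"
      using pq(1) unfolding path_from_to_iff by (metis hd_in_set last_in_set subsetD)+
    then show ?thesis using assms pq unfolding rooted_tree_def by blast
  qed
qed

lemma path_to_root:
  assumes "rooted_tree T" "v \<in> rverts T"
  shows "path_from_to T v (path_to_root T v) (snd T)"
  unfolding path_to_root_def
  by (rule theI') (use assms in \<open>simp add: rooted_tree_def\<close>)

lemma path_to_root_eqI:
  assumes "rooted_tree T" "path_from_to T v p (snd T)"
  shows "path_to_root T v = p"
  unfolding path_to_root_def
  by (rule the_equality, rule assms(2)) (rule rooted_treeD(5)[OF assms(1) _ assms(2)])

lemma path_to_root_Cons:
  assumes "rooted_tree T" "v \<in> rverts T"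
  obtains xs where "path_to_root T v = v # xs"
proof (rule that)
  show "path_to_root T v = v # tl (path_to_root T v)"
    using path_to_root[OF assms] unfolding path_from_to_iff by (metis list.collapse)
qed

lemma path_to_root_not_Nil:
  assumes "rooted_tree T" "v \<in> rverts T"
  shows "path_to_root T v \<noteq> []"
  using path_to_root[OF assms] by (simp add: path_from_to_iff)

lemma path_to_root_suffix:
  assumes T: "rooted_tree T" and v: "v \<in> rverts T" and p: "path_to_root T v = xs @ u # ys"
  shows "u \<in> rverts T" "path_to_root T u = u # ys"
proof -
  have "path_from_to T v (xs @ u # ys) (snd T)" using path_to_root[OF T v] p by simp
  then show "u \<in> rverts T" "path_to_root T u = u # ys"
    by (auto intro!: path_to_root_eqI[OF T] simp: path_from_to_iff successively_append_iff)
qed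

lemma path_to_root_inject:
  assumes "rooted_tree T" "u \<in> rverts T" "v \<in> rverts T" "path_to_root T u = path_to_root T v"
  shows "u = v"
  using path_to_root[OF assms(1,2)] path_to_root[OF assms(1,3)] assms(4)
  by (simp add: path_from_to_iff)

text \<open>By uniqueness of paths, the part of a root path from \<open>u\<close> on is the root
  path of \<open>u\<close>. Ancestry thus becomes the suffix order, and suffixes of one list are
  comparable by length.\<close>

lemma ancestor_iff:
  assumes T: "rooted_tree T"
  shows "ancestor T u v \<longleftrightarrow> u \<in> rverts T \<and> v \<in> rverts T \<and> suffix (path_to_root T u) (path_to_root T v)"
proof
  assume "ancestor T u v"
  then have v: "v \<in> rverts T" and "u \<in> set (path_to_root T v)" by (simp_all add: ancestor_def)
  then obtain xs ys where p: "path_to_root T v = xs @ u # ys" by (meson split_list)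
  note path_to_root_suffix[OF T v p]
  with v p show "u \<in> rverts T \<and> v \<in> rverts T \<and> suffix (path_to_root T u) (path_to_root T v)"
    by (simp add: suffix_def)
next
  assume *: "u \<in> rverts T \<and> v \<in> rverts T \<and> suffix (path_to_root T u) (path_to_root T v)"
  then have "set (path_to_root T u) \<subseteq> set (path_to_root T v)" by (simp add: set_mono_suffix)
  moreover have "u \<in> set (path_to_root T u)"
    using path_to_root_Cons[OF T, of u] * by (metis list.set_intros(1))
  ultimately show "ancestor T u v" using * by (auto simp: ancestor_def)
qed

lemma nca_eqI:
  assumes "ancestor T w x" "ancestor T w y"
    and "\<And>z. \<lbrakk>ancestor T z x; ancestor T z y; z \<noteq> w\<rbrakk> \<Longrightarrow> depth T z < depth T w"
  shows "nca T x y = w"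
  unfolding nca_def arg_max_def is_arg_max_def
proof (rule some_equality)
  show "(ancestor T w x \<and> ancestor T w y) \<and>
      (\<nexists>z. (ancestor T z x \<and> ancestor T z y) \<and> depth T w < depth T z)"
    using assms by (metis order.asym)
  show "z = w" if "(ancestor T z x \<and> ancestor T z y) \<and>
      (\<nexists>u. (ancestor T u x \<and> ancestor T u y) \<and> depth T z < depth T u)" for z
    using assms that by metis
qed

lemma children_iff:
  assumes T: "rooted_tree T"
  shows "c \<in> children T v \<longleftrightarrow>
    v \<in> rverts T \<and> c \<in> rverts T \<and> path_to_root T c = c # path_to_root T v"
proof
  assume "c \<in> children T v"
  then have vc: "(v, c) \<in> parcs (fst T)" and "ancestor T v c" by (auto simp: children_def)
  then have verts: "v \<in> rverts T" "c \<in> rverts T" "v \<noteq> c" "(c, v) \<in> parcs (fst T)"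
    and suf: "suffix (path_to_root T v) (path_to_root T c)"
    using rooted_treeD(4)[OF T vc] ancestor_iff[OF T] by auto
  obtain xs where xs: "path_to_root T c = c # xs" using path_to_root_Cons[OF T verts(2)] .
  obtain ys where ys: "path_to_root T v = v # ys" using path_to_root_Cons[OF T verts(1)] .
  \<comment> \<open>The root path of \<open>v\<close> lies in the tail of the simple root path of
    \<open>c\<close> and so avoids \<open>c\<close>; prepending \<open>c\<close> gives a path, which
    is the root path of \<open>c\<close> by uniqueness.\<close>
  have "suffix (path_to_root T v) xs" using suf verts(3) xs ys by (simp add: suffix_Cons)
  then have "set (path_to_root T v) \<subseteq> set xs" by (rule set_mono_suffix)
  moreover have "c \<notin> set xs" using path_to_root[OF T verts(2)] xs by (simp add: path_from_to_iff)
  ultimately have "c \<notin> set (path_to_root T v)" by blast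
  then have "path_from_to T c (c # path_to_root T v) (snd T)"
    using path_to_root[OF T verts(1)] verts ys
    by (auto simp: path_from_to_iff)
  with verts show "v \<in> rverts T \<and> c \<in> rverts T \<and> path_to_root T c = c # path_to_root T v"
    using path_to_root_eqI[OF T] by blast
next
  assume *: "v \<in> rverts T \<and> c \<in> rverts T \<and> path_to_root T c = c # path_to_root T v"
  obtain ys where ys: "path_to_root T v = v # ys" using path_to_root_Cons[OF T] * by blast
  have "path_from_to T c (c # v # ys) (snd T)" using path_to_root[OF T, of c] * ys by simp
  then have "(c, v) \<in> parcs (fst T)" by (simp add: path_from_to_iff)
  then have "(v, c) \<in> parcs (fst T)" using rooted_treeD(4)[OF T] by blast
  moreover have "ancestor T v c" using * by (auto simp: ancestor_iff[OF T] suffix_Cons)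
  ultimately show "c \<in> children T v" by (simp add: children_def)
qed

text \<open>Including \<open>v\<close> explicitly gives every non-vertex a subtree of size one, as
  \<^const>\<open>sized_tree\<close> demands.\<close>

definition subtree :: "'a rooted_graph \<Rightarrow> 'a \<Rightarrow> 'a set" where
  "subtree T v = insert v {w. ancestor T v w}"

lemma subtree_iff:
  assumes "rooted_tree T" "v \<in> rverts T"
  shows "w \<in> subtree T v \<longleftrightarrow> w \<in> rverts T \<and> suffix (path_to_root T v) (path_to_root T w)"
  using assms by (auto simp: subtree_def ancestor_iff)

lemma subtree_root:
  assumes T: "rooted_tree T"
  shows "subtree T (snd T) = rverts T"
proof -
  have "path_to_root T (snd T) = [snd T]"
    using rooted_treeD(3)[OF T] by (intro path_to_root_eqI[OF T]) (simp add: path_from_to_iff)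
  moreover have "suffix [snd T] (path_to_root T w)" if "w \<in> rverts T" for w
    using path_to_root[OF T that] unfolding path_from_to_iff suffix_def
    by (metis append_butlast_last_id)
  ultimately show ?thesis using subtree_iff[OF T rooted_treeD(3)[OF T]] by auto
qed

lemma subtree_child:
  assumes T: "rooted_tree T" and c: "c \<in> children T v"
  shows "subtree T c \<subseteq> subtree T v" "v \<notin> subtree T c"
proof -
  have *: "v \<in> rverts T" "c \<in> rverts T" "path_to_root T c = c # path_to_root T v"
    using c children_iff[OF T] by auto
  show "subtree T c \<subseteq> subtree T v"
    using * by (auto simp: subtree_iff[OF T] dest: suffix_ConsD)
  show "v \<notin> subtree T c"
    using * by (auto simp: subtree_iff[OF T] dest: suffix_length_le)
qed

lemma children_subtree_disjoint:
  assumes T: "rooted_tree T" and c: "c \<in> children T v" "c' \<in> children T v"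
    and "x \<in> subtree T c" "x \<in> subtree T c'"
  shows "c = c'"
proof -
  have *: "c \<in> rverts T" "path_to_root T c = c # path_to_root T v"
     "c' \<in> rverts T" "path_to_root T c' = c' # path_to_root T v"
    using c children_iff[OF T] by auto
  then have "suffix (c # path_to_root T v) (path_to_root T x)"
    "suffix (c' # path_to_root T v) (path_to_root T x)"
    using assms(4,5) by (auto simp: subtree_iff[OF T])
  then have "suffix (c # path_to_root T v) (c' # path_to_root T v)"
    by (rule suffix_length_suffix) simp
  then show ?thesis by (auto simp: suffix_Cons dest: suffix_length_le)
qed

lemma subtree_unfold:
  assumes T: "rooted_tree T" and v: "v \<in> rverts T"
  shows "subtree T v = insert v (\<Union>c\<in>children T v. subtree T c)"
proof (intro equalityI subsetI)
  fix x assume x: "x \<in> subtree T v"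
  show "x \<in> insert v (\<Union>c\<in>children T v. subtree T c)"
  proof (cases "x = v")
    case False
    obtain xs where x': "x \<in> rverts T" "path_to_root T x = xs @ path_to_root T v"
      using x by (auto simp: subtree_iff[OF T v] suffix_def)
    with False v have "xs \<noteq> []" using path_to_root_inject[OF T] by fastforce
    \<comment> \<open>The vertex just before the root path of \<open>v\<close> begins is the child
      through which \<open>x\<close> is reached.\<close>
    then obtain ys c where "xs = ys @ [c]" by (meson rev_exhaust)
    with x' have px: "path_to_root T x = ys @ c # path_to_root T v" by simp
    note path_to_root_suffix[OF T x'(1) this]
    then have "c \<in> children T v" "x \<in> subtree T c"
      using v x' px by (auto simp: children_iff[OF T] subtree_iff[OF T] suffix_def)
    then show ?thesis by blast
  qed simp
next
  fix x assume "x \<in> insert v (\<Union>c\<in>children T v. subtree T c)"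
  then show "x \<in> subtree T v" using subtree_child(1)[OF T] by (auto simp: subtree_def)
qed

text \<open>The bridge from graphs to child functions: the subtrees of the children are disjoint and
  miss \<open>v\<close>, which gives the recursion for the sizes.\<close>

lemma sized_tree_children:
  assumes T: "rooted_tree T" and d: "\<And>v. v \<in> rverts T \<Longrightarrow> card (children T v) \<le> d"
  shows "sized_tree d (children T) (\<lambda>v. card (subtree T v))"
  unfolding sized_tree_def
proof
  fix v
  have fin: "finite (subtree T w)" for w
    by (rule finite_subset[of _ "insert w (rverts T)"])
      (use rooted_treeD(2)[OF T] in \<open>auto simp: subtree_def ancestor_def\<close>)
  have finc: "finite (children T v)"
    by (rule finite_subset[OF _ rooted_treeD(2)[OF T]]) (auto simp: children_iff[OF T])
  show "finite (children T v) \<and> card (children T v) \<le> d \<and>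
      card (subtree T v) = Suc (\<Sum>c\<in>children T v. card (subtree T c))"
  proof (cases "v \<in> rverts T")
    case True
    have "card (\<Union>c\<in>children T v. subtree T c) = (\<Sum>c\<in>children T v. card (subtree T c))"
      using finc fin children_subtree_disjoint[OF T] by (intro card_UN_disjoint) blast+
    moreover have "v \<notin> (\<Union>c\<in>children T v. subtree T c)" using subtree_child[OF T] by blast
    ultimately show ?thesis
      using d[OF True] finc fin by (simp add: subtree_unfold[OF T True])
  next
    case False
    then have "children T v = {}" "subtree T v = {v}"
      by (auto simp: children_iff[OF T] subtree_def ancestor_iff[OF T])
    then show ?thesis by simp
  qed
qed

section \<open>Nearest common ancestors in terms of child subtrees\<close>

lemma nca_ancestor:
  assumes T: "rooted_tree T" and v: "v \<in> rverts T" and x: "x \<in> subtree T v"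
  shows "nca T v x = v" "nca T x v = v"
proof -
  have a: "ancestor T v x" "ancestor T v v" using v x by (auto simp: subtree_def ancestor_iff[OF T])
  have "depth T z < depth T v" if "ancestor T z v" "z \<noteq> v" for z
  proof -
    have z: "z \<in> rverts T" "suffix (path_to_root T z) (path_to_root T v)"
      using that by (auto simp: ancestor_iff[OF T])
    moreover have "path_to_root T z \<noteq> path_to_root T v"
      using path_to_root_inject[OF T z(1) v] that by blast
    ultimately have "length (path_to_root T z) < length (path_to_root T v)"
      by (metis strict_suffix_def suffix_length_less)
    moreover have "path_to_root T z \<noteq> []" by (rule path_to_root_not_Nil[OF T z(1)])
    ultimately show ?thesis by (cases "path_to_root T z") (auto simp: depth_def)
  qed
  then show "nca T v x = v" "nca T x v = v" using a by (auto intro!: nca_eqI)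
qed

text \<open>A common ancestor whose root path is as long as that of \<open>v\<close> is
  \<open>v\<close>; one with a longer root path would lie in the subtrees of both \<open>c\<close>
  and \<open>c'\<close>, which are disjoint.\<close>

lemma nca_distinct_children:
  assumes T: "rooted_tree T" and c: "c \<in> children T v" "c' \<in> children T v" "c \<noteq> c'"
    and x: "x \<in> subtree T c" and y: "y \<in> subtree T c'"
  shows "nca T x y = v"
proof (rule nca_eqI)
  have v: "v \<in> rverts T" and *: "c \<in> rverts T" "path_to_root T c = c # path_to_root T v"
     "c' \<in> rverts T" "path_to_root T c' = c' # path_to_root T v"
    using c children_iff[OF T] by auto
  have xy: "x \<in> rverts T" "y \<in> rverts T" "suffix (path_to_root T c) (path_to_root T x)"
    "suffix (path_to_root T c') (path_to_root T y)"
    using x y * by (auto simp: subtree_iff[OF T])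
  show "ancestor T v x" "ancestor T v y"
    using v xy * by (auto simp: ancestor_iff[OF T] dest: suffix_ConsD)
  then have vx: "suffix (path_to_root T v) (path_to_root T x)" by (simp add: ancestor_iff[OF T])
  fix z assume "ancestor T z x" "ancestor T z y" "z \<noteq> v"
  then have z: "z \<in> rverts T" "suffix (path_to_root T z) (path_to_root T x)"
    "suffix (path_to_root T z) (path_to_root T y)" by (auto simp: ancestor_iff[OF T])
  have "length (path_to_root T z) < length (path_to_root T v)"
  proof (rule ccontr)
    assume "\<not> ?thesis"
    then consider "length (path_to_root T z) = length (path_to_root T v)" |
      "length (path_to_root T c) \<le> length (path_to_root T z)"
      "length (path_to_root T c') \<le> length (path_to_root T z)" using * by fastforce
    then show False
    proof cases
      case 1
      then have "path_to_root T z = path_to_root T v"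
        using z(2) vx by (metis suffix_length_suffix suffix_order.antisym order_refl)
      then show False using path_to_root_inject[OF T z(1) v] \<open>z \<noteq> v\<close> by blast
    next
      case 2
      then have "suffix (path_to_root T c) (path_to_root T z)"
        "suffix (path_to_root T c') (path_to_root T z)"
        using xy z suffix_length_suffix by metis+
      then have "z \<in> subtree T c" "z \<in> subtree T c'" using * z by (auto simp: subtree_iff[OF T])
      then show False using children_subtree_disjoint[OF T c(1,2)] c(3) by blast
    qed
  qed
  moreover have "path_to_root T z \<noteq> []" by (rule path_to_root_not_Nil[OF T z(1)])
  ultimately show "depth T z < depth T v" by (cases "path_to_root T z") (auto simp: depth_def)
qed

text \<open>Allows an embedding of a child subtree to be applied to the nearest common ancestor of
  two of its vertices. The induction descends until \<open>x\<close> and \<open>y\<close> lie below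
  different children or one of them is \<open>v\<close>.\<close>

lemma nca_in_subtree:
  assumes T: "rooted_tree T" and "v \<in> rverts T" "x \<in> subtree T v" "y \<in> subtree T v"
  shows "nca T x y \<in> subtree T v"
  using assms(2-4)
proof (induction "card (subtree T v)" arbitrary: v rule: less_induct)
  case less
  have v: "v \<in> subtree T v" by (simp add: subtree_def)
  consider "x = v" | "y = v" |
    c c' where "c \<in> children T v" "x \<in> subtree T c" "c' \<in> children T v" "y \<in> subtree T c'"
    using less.prems unfolding subtree_unfold[OF T less.prems(1)] by blast
  then show ?case
  proof cases
    case 3
    show ?thesis
    proof (cases "c = c'")
      case True
      have "finite (subtree T v)"
        by (rule finite_subset[OF _ rooted_treeD(2)[OF T]])
          (auto simp: subtree_iff[OF T less.prems(1)])
      then have "card (subtree T c) < card (subtree T v)"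
        using subtree_child[OF T 3(1)] v by (intro psubset_card_mono) auto
      moreover have "c \<in> rverts T" using 3(1) by (simp add: children_iff[OF T])
      ultimately show ?thesis
        using less.hyps 3 True subtree_child(1)[OF T 3(1)] by blast
    qed (use nca_distinct_children[OF T] 3 v in auto)
  qed (use nca_ancestor[OF T less.prems(1)] less.prems v in auto)
qed

section \<open>Addresses of ordered trees\<close>

text \<open>A vertex is encoded by the branch numbers leading to it from the root, so ancestors
  become prefixes. The form \<open>map addresses ts ! i\<close> is the shape in which primitive
  recursion through a list accepts recursive calls.\<close>

primrec addresses :: "rose \<Rightarrow> nat list set" where
  "addresses (Node ts) = insert [] (\<Union>i<length ts. (#) i ` (map addresses ts ! i))"

lemma addresses_Node:
  "addresses (Node ts) = insert [] (\<Union>i<length ts. (#) i ` addresses (ts ! i))"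
  by auto

lemma Cons_in_addresses:
  "i # x \<in> addresses (Node ts) \<longleftrightarrow> i < length ts \<and> x \<in> addresses (ts ! i)"
  by auto

declare addresses.simps [simp del]

lemma finite_addresses: "finite (addresses t)"
  by (induction t) (auto simp: addresses_Node)

lemma card_addresses: "card (addresses t) \<le> nodes t"
proof (induction t)
  case (Node ts)
  let ?B = "\<Union>i<length ts. (#) i ` addresses (ts ! i)"
  have "card ?B \<le> (\<Sum>i<length ts. card ((#) i ` addresses (ts ! i)))"
    by (rule card_UN_le) simp
  also have "\<dots> = (\<Sum>i<length ts. card (addresses (ts ! i)))"
    by (intro sum.cong refl card_image) (simp add: inj_on_def)
  also have "\<dots> \<le> (\<Sum>i<length ts. nodes (ts ! i))"
    using Node by (intro sum_mono) simp
  also have "\<dots> = sum_list (map nodes ts)"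
    by (simp add: sum_list_sum_nth atLeast0LessThan)
  finally have "card ?B \<le> sum_list (map nodes ts)" .
  moreover have "card (insert [] ?B) \<le> Suc (card ?B)" by (rule card_insert_le_m1) simp_all
  ultimately show ?case by (simp add: addresses_Node)
qed

lemma Nil_in_addresses: "[] \<in> addresses t"
  by (cases t) (simp add: addresses_Node)

lemma prefix_addresses: "\<lbrakk>x \<in> addresses t; prefix p x\<rbrakk> \<Longrightarrow> p \<in> addresses t"
proof (induction t arbitrary: x p)
  case (Node ts)
  show ?case
  proof (cases p)
    case (Cons i q)
    with Node.prems obtain y where x: "x = i # y" "prefix q y" by (cases x) auto
    with Node.prems have "i < length ts" "y \<in> addresses (ts ! i)"
      by (simp_all add: Cons_in_addresses)
    with Node.IH[OF nth_mem] x Cons show ?thesis by (simp add: Cons_in_addresses)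
  qed (simp add: addresses_Node)
qed

text \<open>In the \<open>node\<close> case \<open>v\<close> goes to \<open>[]\<close> and the
  subtree of the \<open>i\<close>-th child goes below branch \<open>i\<close>; addresses from
  different child subtrees differ in the first entry, so their longest common prefix is
  \<open>[]\<close>, the image of \<open>v\<close>. In the \<open>below\<close> case a fixed entry
  is prepended, which commutes with longest common prefixes.\<close>

lemma topo_minor_embedding:
  assumes T: "rooted_tree T"
  shows "topo_minor (children T) v t \<Longrightarrow> v \<in> rverts T \<Longrightarrow>
    \<exists>\<phi>. inj_on \<phi> (subtree T v) \<and> \<phi> ` subtree T v \<subseteq> addresses t \<and>
      (\<forall>x\<in>subtree T v. \<forall>y\<in>subtree T v. \<phi> (nca T x y) = longest_common_prefix (\<phi> x) (\<phi> y))"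
proof (induction v t rule: topo_minor.induct)
  case (below t ts v)
  then obtain \<phi> where \<phi>: "inj_on \<phi> (subtree T v)" "\<phi> ` subtree T v \<subseteq> addresses t"
    "\<And>x y. \<lbrakk>x \<in> subtree T v; y \<in> subtree T v\<rbrakk> \<Longrightarrow> \<phi> (nca T x y) = longest_common_prefix (\<phi> x) (\<phi> y)"
    by blast
  obtain i where i: "i < length ts" "ts ! i = t" using below(1) by (meson in_set_conv_nth)
  show ?case
    by (rule exI[of _ "\<lambda>x. i # \<phi> x"])
      (use \<phi> i in \<open>auto simp: inj_on_def Cons_in_addresses image_subset_iff\<close>)
next
  case (node cs v ts)
  have ch: "cs ! i \<in> children T v" "cs ! i \<in> rverts T" if "i < length cs" for i
  proof -
    show "cs ! i \<in> children T v" using node(2) that by (metis nth_mem)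
    then show "cs ! i \<in> rverts T" by (simp add: children_iff[OF T])
  qed
  let ?good = "\<lambda>i \<phi>. inj_on \<phi> (subtree T (cs ! i)) \<and> \<phi> ` subtree T (cs ! i) \<subseteq> addresses (ts ! i) \<and>
    (\<forall>x\<in>subtree T (cs ! i). \<forall>y\<in>subtree T (cs ! i).
       \<phi> (nca T x y) = longest_common_prefix (\<phi> x) (\<phi> y))"
  have "\<forall>i. \<exists>\<phi>. i < length cs \<longrightarrow> ?good i \<phi>" using node(4) ch(2) by blast
  then obtain f where f: "\<And>i. i < length cs \<Longrightarrow> ?good i (f i)" by metis
  define idx where "idx x = (THE i. i < length cs \<and> x \<in> subtree T (cs ! i))" for x
  define \<phi> where "\<phi> x = (if x = v then [] else idx x # f (idx x) x)" for x
  have \<phi>_v: "\<phi> v = []" by (simp add: \<phi>_def)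
  have same: "i = j" if "i < length cs" "j < length cs" "x \<in> subtree T (cs ! i)" "x \<in> subtree T (cs ! j)"
    for i j x
    using children_subtree_disjoint[OF T ch(1) ch(1) that(3,4)] that node(1) nth_eq_iff_index_eq by blast
  have \<phi>_sub: "\<phi> x = i # f i x" if "i < length cs" "x \<in> subtree T (cs ! i)" for i x
  proof -
    have "idx x = i" unfolding idx_def using that same by (intro the_equality) blast+
    then show ?thesis unfolding \<phi>_def using subtree_child(2)[OF T ch(1)[OF that(1)]] that by auto
  qed
  have split: "x = v \<or> (\<exists>i<length cs. x \<in> subtree T (cs ! i))" if "x \<in> subtree T v" for x
    using that node(2) unfolding subtree_unfold[OF T node.prems] by (metis UN_E in_set_conv_nth insertE)
  have inj: "inj_on \<phi> (subtree T v)"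
  proof (rule inj_onI)
    fix x y assume "x \<in> subtree T v" "y \<in> subtree T v" "\<phi> x = \<phi> y"
    with split[of x] split[of y] f show "x = y"
      by (fastforce simp: \<phi>_v \<phi>_sub dest: inj_onD)
  qed
  have img: "\<phi> ` subtree T v \<subseteq> addresses (Node ts)"
  proof
    fix a assume "a \<in> \<phi> ` subtree T v"
    then obtain x where x: "x \<in> subtree T v" "a = \<phi> x" by blast
    from split[OF x(1)] show "a \<in> addresses (Node ts)"
    proof (elim disjE exE conjE)
      fix i assume i: "i < length cs" "x \<in> subtree T (cs ! i)"
      then have "f i x \<in> addresses (ts ! i)" "i < length ts" using f[OF i(1)] node(3) by auto
      then show ?thesis using x(2) \<phi>_sub[OF i] by (simp add: Cons_in_addresses)
    qed (simp add: x(2) \<phi>_v Nil_in_addresses)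
  qed
  have "\<phi> (nca T x y) = longest_common_prefix (\<phi> x) (\<phi> y)"
    if xy: "x \<in> subtree T v" "y \<in> subtree T v" for x y
  proof -
    consider "x = v" | "y = v" |
      i j where "i < length cs" "x \<in> subtree T (cs ! i)" "j < length cs" "y \<in> subtree T (cs ! j)"
      using split xy by blast
    then show ?thesis
    proof cases
      case 3
      show ?thesis
      proof (cases "i = j")
        case True
        then have "nca T x y \<in> subtree T (cs ! i)" using 3 nca_in_subtree[OF T ch(2)] by blast
        then show ?thesis using 3 True f[of i] by (simp add: \<phi>_sub)
      next
        case False
        then have "cs ! i \<noteq> cs ! j" using 3 node(1) nth_eq_iff_index_eq by blast
        then have "nca T x y = v" using nca_distinct_children[OF T ch(1) ch(1)] 3 by blast
        then show ?thesis using 3 False by (simp add: \<phi>_v \<phi>_sub)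
      qed
    qed (use nca_ancestor[OF T node.prems] xy in \<open>auto simp: \<phi>_v\<close>)
  qed
  with inj img show ?case by blast
qed

section \<open>The graph of a prefix-closed set\<close>

lemma pair_graphI:
  assumes "finite (pverts G)"
    and "\<And>a b. (a, b) \<in> parcs G \<Longrightarrow> a \<in> pverts G \<and> b \<in> pverts G \<and> a \<noteq> b \<and> (b, a) \<in> parcs G"
  shows "pair_graph G"
proof -
  have "finite (parcs G)"
    by (rule finite_subset[of _ "pverts G \<times> pverts G"]) (use assms in auto)
  moreover have "symmetric (with_proj G)"
    unfolding symmetric_def by (rule symI) (use assms(2) in simp)
  ultimately show ?thesis
    by unfold_locales (use assms in auto)
qed

text \<open>Both arc directions are added because the graphs are symmetric digraphs. Growing trees
  by leaves lets uniqueness of paths be inherited from the smaller tree.\<close>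

definition add_leaf :: "'a \<Rightarrow> 'a \<Rightarrow> 'a rooted_graph \<Rightarrow> 'a rooted_graph" where
  "add_leaf a w T =
     (\<lparr>pverts = insert w (rverts T), parcs = {(a, w), (w, a)} \<union> parcs (fst T)\<rparr>, snd T)"

context
  fixes T :: "'a rooted_graph" and a w :: 'a
  assumes T: "rooted_tree T" and a: "a \<in> rverts T" and w: "w \<notin> rverts T"
begin

lemma arc_add_leaf:
  "(x, y) \<in> parcs (fst (add_leaf a w T)) \<longleftrightarrow>
    (x, y) \<in> parcs (fst T) \<or> x = a \<and> y = w \<or> x = w \<and> y = a"
  by (auto simp: add_leaf_def)

lemma arc_add_leaf_w:
  "(w, y) \<in> parcs (fst (add_leaf a w T)) \<longleftrightarrow> y = a"
  "(x, w) \<in> parcs (fst (add_leaf a w T)) \<longleftrightarrow> x = a"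
  using rooted_treeD(4)[OF T, of w] rooted_treeD(4)[OF T, of _ w] w a by (auto simp: arc_add_leaf)

lemma arc_add_leaf_old:
  "\<lbrakk>x \<noteq> w; y \<noteq> w\<rbrakk> \<Longrightarrow> (x, y) \<in> parcs (fst (add_leaf a w T)) \<longleftrightarrow> (x, y) \<in> parcs (fst T)"
  by (auto simp: arc_add_leaf)

lemma verts_add_leaf: "rverts (add_leaf a w T) = insert w (rverts T)"
  by (simp add: add_leaf_def)

lemma path_add_leaf_avoiding:
  assumes "w \<notin> set p"
  shows "path_from_to (add_leaf a w T) u p v \<longleftrightarrow> path_from_to T u p v"
proof -
  have "successively (\<lambda>x y. (x, y) \<in> parcs (fst (add_leaf a w T))) p \<longleftrightarrow>
      successively (\<lambda>x y. (x, y) \<in> parcs (fst T)) p"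
    by (rule successively_cong) (use assms arc_add_leaf_old in metis)+
  then show ?thesis using assms unfolding path_from_to_iff verts_add_leaf by auto
qed

lemma path_verts: "path_from_to T u p v \<Longrightarrow> w \<notin> set p"
  using w unfolding path_from_to_iff by blast

text \<open>The only neighbour of \<open>w\<close> is \<open>a\<close>, so a path between other
  vertices that visits \<open>w\<close> would contain \<open>a\<close> both before and after
  \<open>w\<close>.\<close>

lemma path_add_leaf_old:
  assumes "u \<noteq> w" "v \<noteq> w"
  shows "path_from_to (add_leaf a w T) u p v \<longleftrightarrow> path_from_to T u p v"
proof -
  have "w \<notin> set p" if p: "path_from_to (add_leaf a w T) u p v"
  proof
    assume "w \<in> set p"
    then obtain xs ys where xy: "p = xs @ w # ys" by (meson split_list)
    then have ne: "xs \<noteq> []" "ys \<noteq> []"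
      using p assms unfolding path_from_to_iff by (cases xs; cases ys; simp)+
    have "successively (\<lambda>x y. (x, y) \<in> parcs (fst (add_leaf a w T))) (xs @ w # ys)"
      using p xy unfolding path_from_to_iff by blast
    then have "last xs = a" "hd ys = a"
      using ne by (simp_all add: successively_append_iff successively_Cons arc_add_leaf_w)
    then have "a \<in> set xs" "a \<in> set ys" using ne last_in_set hd_in_set by metis+
    then show False using p xy unfolding path_from_to_iff by auto
  qed
  then show ?thesis using path_add_leaf_avoiding path_verts by blast
qed

lemma path_add_leaf_from:
  assumes "v \<noteq> w"
  shows "path_from_to (add_leaf a w T) w p v \<longleftrightarrow> (\<exists>q. p = w # q \<and> path_from_to T a q v)"
proof
  assume p: "path_from_to (add_leaf a w T) w p v"
  then obtain q where q: "p = w # q" unfolding path_from_to_iff by (cases p) auto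
  with p assms have "w \<notin> set q" "path_from_to (add_leaf a w T) a q v"
    unfolding path_from_to_iff
    by (auto simp: successively_Cons arc_add_leaf_w split: if_splits)
  with q show "\<exists>q. p = w # q \<and> path_from_to T a q v" using path_add_leaf_avoiding by blast
next
  assume "\<exists>q. p = w # q \<and> path_from_to T a q v"
  then obtain q where q: "p = w # q" "path_from_to T a q v" by blast
  then have "w \<notin> set q" "path_from_to (add_leaf a w T) a q v"
    using path_verts path_add_leaf_avoiding by blast+
  with q(1) show "path_from_to (add_leaf a w T) w p v"
    unfolding path_from_to_iff by (auto simp: successively_Cons arc_add_leaf_w verts_add_leaf)
qed

text \<open>Transfers uniqueness from paths starting in \<open>w\<close> to paths ending in
  \<open>w\<close>.\<close>

lemma path_add_leaf_rev:
  "path_from_to (add_leaf a w T) u p v \<longleftrightarrow> path_from_to (add_leaf a w T) v (rev p) u"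
proof -
  have "(x, y) \<in> parcs (fst (add_leaf a w T)) \<longleftrightarrow> (y, x) \<in> parcs (fst (add_leaf a w T))" for x y
    using rooted_treeD(4)[OF T] by (auto simp: arc_add_leaf)
  then show ?thesis unfolding path_from_to_iff by (auto simp: hd_rev last_rev)
qed

lemma path_add_leaf_self: "path_from_to (add_leaf a w T) w p w \<longleftrightarrow> p = [w]"
  unfolding path_from_to_iff verts_add_leaf
  by (cases p) (simp_all, use last_in_set in force)

lemma rooted_tree_add_leaf: "rooted_tree (add_leaf a w T)"
proof -
  have old: "\<exists>!p. path_from_to T u p v" if "u \<in> rverts T" "v \<in> rverts T" for u v
    using T that unfolding rooted_tree_def by blast
  have from_w: "\<exists>!p. path_from_to (add_leaf a w T) w p v" if v: "v \<in> rverts T" for v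
  proof -
    have "v \<noteq> w" using v w by blast
    then show ?thesis using old[OF a v] unfolding path_add_leaf_from[OF \<open>v \<noteq> w\<close>] by blast
  qed
  have to_w: "\<exists>!p. path_from_to (add_leaf a w T) v p w" if "v \<in> rverts T" for v
    using from_w[OF that] path_add_leaf_rev rev_rev_ident by metis
  have "\<exists>!p. path_from_to (add_leaf a w T) u p v"
    if uv: "u \<in> rverts (add_leaf a w T)" "v \<in> rverts (add_leaf a w T)" for u v
  proof (cases "u = w"; cases "v = w")
    assume "u = w" "v = w"
    then show ?thesis by (simp add: path_add_leaf_self)
  next
    assume "u \<noteq> w" "v \<noteq> w"
    then show ?thesis using uv old by (simp add: path_add_leaf_old verts_add_leaf)
  qed (use uv from_w to_w in \<open>auto simp: verts_add_leaf\<close>)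
  moreover have "pair_graph (fst (add_leaf a w T))"
  proof (rule pair_graphI)
    show "finite (rverts (add_leaf a w T))"
      using rooted_treeD(2)[OF T] by (simp add: verts_add_leaf)
    show "x \<in> rverts (add_leaf a w T) \<and> y \<in> rverts (add_leaf a w T) \<and> x \<noteq> y \<and>
        (y, x) \<in> parcs (fst (add_leaf a w T))"
      if "(x, y) \<in> parcs (fst (add_leaf a w T))" for x y
      using that rooted_treeD(4)[OF T, of x y] a w
      unfolding arc_add_leaf verts_add_leaf by blast
  qed
  moreover have "snd (add_leaf a w T) \<in> rverts (add_leaf a w T)"
    using rooted_treeD(3)[OF T] by (simp add: add_leaf_def)
  ultimately show ?thesis unfolding rooted_tree_def by blast
qed

lemma path_to_root_add_leaf:
  "v \<in> rverts T \<Longrightarrow> path_to_root (add_leaf a w T) v = path_to_root T v"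
  "path_to_root (add_leaf a w T) w = w # path_to_root T a"
proof -
  have r: "snd (add_leaf a w T) = snd T" "snd T \<noteq> w"
    using rooted_treeD(3)[OF T] w by (auto simp: add_leaf_def)
  show "path_to_root (add_leaf a w T) v = path_to_root T v" if v: "v \<in> rverts T"
  proof -
    have "v \<noteq> w" using v w by blast
    with r show ?thesis
      using path_to_root[OF T v]
      by (intro path_to_root_eqI[OF rooted_tree_add_leaf]) (simp add: path_add_leaf_old)
  qed
  show "path_to_root (add_leaf a w T) w = w # path_to_root T a"
    using path_to_root[OF T a] r
    by (intro path_to_root_eqI[OF rooted_tree_add_leaf]) (simp add: path_add_leaf_from)
qed

end

lemma rooted_tree_singleton: "rooted_tree (\<lparr>pverts = {v}, parcs = {}\<rparr>, v)"
proof -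
  have "path_from_to (\<lparr>pverts = {v}, parcs = {}\<rparr>, v) v p v \<longleftrightarrow> p = [v]" for p
    unfolding path_from_to_iff by (cases p) (auto split: if_splits)
  moreover have "pair_graph \<lparr>pverts = {v}, parcs = {}\<rparr>" by (rule pair_graphI) auto
  ultimately show ?thesis unfolding rooted_tree_def by simp
qed

text \<open>A longest element of \<open>P\<close> is a proper prefix of no other, so the set stays
  prefix-closed without it; by induction the rest is a tree, and the element is attached as a leaf
  to its longest proper prefix.\<close>

lemma prefix_closed_tree:
  fixes e :: "'b list \<Rightarrow> 'a"
  assumes e: "inj e" and "finite P" "[] \<in> P" "\<forall>x\<in>P. \<forall>p. prefix p x \<longrightarrow> p \<in> P"
  shows "\<exists>S. rooted_tree S \<and> rverts S = e ` P \<and>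
    (\<forall>x\<in>P. path_to_root S (e x) = map e (rev (prefixes x)))"
  using assms(2-4)
proof (induction "card P" arbitrary: P rule: less_induct)
  case less
  show ?case
  proof (cases "P = {[]}")
    case True
    let ?S = "(\<lparr>pverts = {e []}, parcs = {}\<rparr>, e [])"
    have "path_to_root ?S (e []) = [e []]"
      by (rule path_to_root_eqI[OF rooted_tree_singleton]) (simp add: path_from_to_iff)
    then show ?thesis using True rooted_tree_singleton by (intro exI[of _ ?S]) auto
  next
    case False
    have "Max (length ` P) \<in> length ` P" using less.prems by (intro Max_in) auto
    then obtain x where x: "x \<in> P" "length x = Max (length ` P)" by auto
    have long: "length z \<le> length x" if "z \<in> P" for z
      using x(2) less.prems(1) that by simp
    have "x \<noteq> []"
    proof
      assume "x = []"
      with long have "P \<subseteq> {[]}" by auto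
      with False less.prems(2) show False by blast
    qed
    then obtain y i where y: "x = y @ [i]" by (meson rev_exhaust)
    define P' where "P' = P - {x}"
    have "y \<in> P'" using less.prems(3) x(1) y by (simp add: P'_def)
    have card: "card P' < card P" unfolding P'_def using less.prems(1) x(1) by (rule card_Diff1_less)
    have P': "finite P'" "[] \<in> P'" using less.prems y by (auto simp: P'_def)
    have "p \<in> P'" if z: "z \<in> P'" and p: "prefix p z" for z p
    proof -
      have "p \<noteq> x"
      proof
        assume "p = x"
        with z p long[of z] show False
          unfolding P'_def using prefix_length_le[OF p] by (auto simp: prefix_def)
      qed
      then show ?thesis using less.prems(3) p z by (auto simp: P'_def)
    qed
    then have closed: "\<forall>z\<in>P'. \<forall>p. prefix p z \<longrightarrow> p \<in> P'" by blast
    obtain S where S: "rooted_tree S" "rverts S = e ` P'"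
      "\<And>z. z \<in> P' \<Longrightarrow> path_to_root S (e z) = map e (rev (prefixes z))"
      using less.hyps[OF card P' closed] by blast
    have ey: "e y \<in> rverts S" using S(2) \<open>y \<in> P'\<close> by blast
    have ex: "e x \<notin> rverts S" using S(2) e by (auto simp: P'_def inj_eq)
    have "rverts (add_leaf (e y) (e x) S) = e ` P"
      using verts_add_leaf[OF S(1) ey ex] S(2) x(1) by (auto simp: P'_def)
    moreover have "path_to_root (add_leaf (e y) (e x) S) (e z) = map e (rev (prefixes z))"
      if z: "z \<in> P" for z
    proof (cases "z = x")
      case True
      then show ?thesis
        using path_to_root_add_leaf(2)[OF S(1) ey ex] S(3)[OF \<open>y \<in> P'\<close>] y by simp
    next
      case False
      with z have "z \<in> P'" by (simp add: P'_def)
      then show ?thesis using path_to_root_add_leaf(1)[OF S(1) ey ex, of "e z"] S(2,3) by simp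
    qed
    ultimately show ?thesis using rooted_tree_add_leaf[OF S(1) ey ex] by blast
  qed
qed

text \<open>The ancestors of \<open>e x\<close> are the images of the prefixes of \<open>x\<close>,
  and depth is length.\<close>

lemma nca_prefix_closed_tree:
  fixes e :: "'b list \<Rightarrow> 'a"
  assumes e: "inj e" and closed: "\<And>x p. \<lbrakk>x \<in> P; prefix p x\<rbrakk> \<Longrightarrow> p \<in> P"
    and S: "rverts S = e ` P" "\<And>x. x \<in> P \<Longrightarrow> path_to_root S (e x) = map e (rev (prefixes x))"
    and xy: "x \<in> P" "y \<in> P"
  shows "nca S (e x) (e y) = e (longest_common_prefix x y)"
proof -
  have anc: "ancestor S z (e x) \<longleftrightarrow> (\<exists>p. z = e p \<and> prefix p x)" if "x \<in> P" for x z
    using that S by (auto simp: ancestor_def)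
  have depth: "depth S (e x) = length x" if "x \<in> P" for x
    using that S by (simp add: depth_def)
  let ?l = "longest_common_prefix x y"
  have l: "prefix ?l x" "prefix ?l y"
    by (rule longest_common_prefix_prefix1 longest_common_prefix_prefix2)+
  show ?thesis
  proof (rule nca_eqI)
    show "ancestor S (e ?l) (e x)" "ancestor S (e ?l) (e y)" using xy l by (auto simp: anc)
    fix z assume "ancestor S z (e x)" "ancestor S z (e y)" "z \<noteq> e ?l"
    then obtain p where p: "z = e p" "prefix p x" "prefix p y" "p \<noteq> ?l"
      using e by (auto simp: anc xy inj_eq)
    then have "prefix p ?l" by (intro longest_common_prefix_max_prefix)
    with p(4) have "length p < length ?l"
      by (simp add: prefix_length_less strict_prefix_def)
    then show "depth S z < depth S (e ?l)"
      using p(1) depth closed[OF xy(1)] p(2) l(1) by simp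
  qed
qed

text \<open>\<open>S\<close> is the tree of addresses of \<open>t\<close>, coded as natural numbers
  by \<open>to_nat\<close>; a tree in \<open>F\<close> embeds by its address map followed by the
  coding.\<close>

lemma nca_universal_tree_exists:
  fixes F :: "nat rooted_graph set"
  assumes t: "universal d n t"
    and F: "\<And>T. T \<in> F \<Longrightarrow> rooted_tree T \<and> card (rverts T) = n \<and>
      (\<forall>v\<in>rverts T. card (children T v) \<le> d)"
  shows "\<exists>S :: nat rooted_graph. nca_universal_tree S F \<and> card (rverts S) \<le> nodes t"
proof -
  define e :: "nat list \<Rightarrow> nat" where "e = to_nat"
  have e: "inj e" unfolding e_def by (rule inj_to_nat)
  have "\<forall>x\<in>addresses t. \<forall>p. prefix p x \<longrightarrow> p \<in> addresses t"
    using prefix_addresses by blast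
  from prefix_closed_tree[OF e finite_addresses Nil_in_addresses this] obtain S where S: "rooted_tree S" "rverts S = e ` addresses t"
    "\<And>x. x \<in> addresses t \<Longrightarrow> path_to_root S (e x) = map e (rev (prefixes x))"
    by blast
  have nca: "nca S (e x) (e y) = e (longest_common_prefix x y)"
    if "x \<in> addresses t" "y \<in> addresses t" for x y
    by (rule nca_prefix_closed_tree[OF e prefix_addresses S(2,3) that])
  have "\<exists>\<phi>. inj_on \<phi> (rverts T) \<and> \<phi> ` rverts T \<subseteq> rverts S \<and>
      (\<forall>u\<in>rverts T. \<forall>v\<in>rverts T. \<phi> (nca T u v) = nca S (\<phi> u) (\<phi> v))" if "T \<in> F" for T
  proof -
    have T: "rooted_tree T" "card (rverts T) = n" and d: "\<And>v. v \<in> rverts T \<Longrightarrow> card (children T v) \<le> d"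
      using F[OF that] by auto
    have "topo_minor (children T) (snd T) t"
      using universalD[OF t sized_tree_children[OF T(1) d], of "snd T"] T subtree_root[OF T(1)]
      by simp
    from topo_minor_embedding[OF T(1) this rooted_treeD(3)[OF T(1)]] subtree_root[OF T(1)]
    obtain \<phi> where \<phi>: "inj_on \<phi> (rverts T)" "\<phi> ` rverts T \<subseteq> addresses t"
      "\<And>x y. \<lbrakk>x \<in> rverts T; y \<in> rverts T\<rbrakk> \<Longrightarrow> \<phi> (nca T x y) = longest_common_prefix (\<phi> x) (\<phi> y)"
      by auto
    have "inj_on (e \<circ> \<phi>) (rverts T)"
      using \<phi>(1) e by (meson comp_inj_on inj_on_subset subset_UNIV)
    moreover have "(e \<circ> \<phi>) ` rverts T \<subseteq> rverts S" using \<phi>(2) S(2) by auto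
    moreover have "(e \<circ> \<phi>) (nca T u v) = nca S ((e \<circ> \<phi>) u) ((e \<circ> \<phi>) v)"
      if "u \<in> rverts T" "v \<in> rverts T" for u v
      using nca[of "\<phi> u" "\<phi> v"] \<phi>(2,3) that by (simp add: image_subset_iff)
    ultimately show ?thesis by blast
  qed
  moreover have "card (rverts S) \<le> nodes t"
    using card_image_le[OF finite_addresses[of t], of e] card_addresses[of t] S(2) by simp
  ultimately show ?thesis unfolding nca_universal_tree_def using S(1) by blast
qed

section \<open>Universal spines\<close>

text \<open>Both powers are split as a factor times a power with exponent \<open>c - 1\<close>,
  which is monotone. The gain pays for the single vertex that a construction step adds.\<close>

lemma powr_add_ge:
  fixes x y c :: real
  assumes "x \<ge> 0" "y \<ge> 0" "c \<ge> 1"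
  shows "x powr c + y * (x + y) powr (c - 1) \<le> (x + y) powr c"
proof -
  have e: "z powr c = z * z powr (c - 1)" if "z \<ge> 0" for z :: real
    using that by (cases "z = 0") (auto simp: powr_diff)
  have "x powr c \<le> x * (x + y) powr (c - 1)"
    using assms by (auto simp: e intro!: mult_left_mono powr_mono2)
  then show ?thesis using assms by (simp add: e[of "x + y"] algebra_simps)
qed

text \<open>\<open>t\<close> is the spine for paths that lose at most \<open>m\<close> in size,
  ending in \<open>rest\<close>. As \<open>rest\<close> is arbitrary in the induction, two half
  spines can be stacked: the lower one ends in \<open>rest\<close> and is the first branch of
  \<open>mid\<close>, and the upper one ends in \<open>mid\<close>.\<close>

lemma spine:
  fixes c K Z :: real
  assumes F: "\<And>j. 0 < j \<Longrightarrow> j < n \<Longrightarrow> universal d j (F j) \<and> real (nodes (F j)) \<le> real j powr c"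
    and c: "c \<ge> 1" and K: "K \<ge> 0" "2 * K * (1/2) powr c + Z \<le> K"
    and Z: "Z \<ge> 1" "\<And>k. (\<Sum>i=1..d-1. real (k div i) powr c) \<le> Z * real k powr c"
    and "m \<le> n"
  shows "\<exists>t. real (nodes t) \<le> real (nodes rest) + K * real m powr c \<and>
    (\<forall>(ch :: nat \<Rightarrow> nat set) sz u v. sized_tree d ch sz \<longrightarrow> descendant ch u v \<longrightarrow>
       sz u \<le> sz v + m \<longrightarrow> topo_minor ch v rest \<longrightarrow> topo_minor ch u t)"
  using \<open>m \<le> n\<close>
proof (induction m arbitrary: rest rule: less_induct)
  case (less m)
  show ?case
  proof (cases "m = 0")
    case True
    have "u = v" if "sized_tree d ch sz" "descendant ch u v" "sz u \<le> sz v + m"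
      for ch :: "nat \<Rightarrow> nat set" and sz u v
      using that(2)
    proof (cases rule: converse_rtranclpE)
      case (step y)
      then show ?thesis
        using descendant_size_le[OF that(1) step(2)] child_size_less[OF that(1) step(1)] that(3) True
        by linarith
    qed
    then show ?thesis using K(1) by (intro exI[of _ rest]) auto
  next
    case False
    define h where "h = m div 2"
    have h: "h < m" "h \<le> n" "m \<le> 2 * h + 1" using False less.prems by (auto simp: h_def)
    obtain t1 where t1: "real (nodes t1) \<le> real (nodes rest) + K * real h powr c"
      and t1_minor: "\<And>(ch :: nat \<Rightarrow> nat set) sz u v. \<lbrakk>sized_tree d ch sz; descendant ch u v;
        sz u \<le> sz v + h; topo_minor ch v rest\<rbrakk> \<Longrightarrow> topo_minor ch u t1"
      using less.IH[OF h(1,2), of rest] by blast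
    \<comment> \<open>The first branch takes the path child of the cut vertex. The at most
      \<open>d - 1\<close> other children have total size at most \<open>m - 1\<close>, since the
      cut vertex itself counts for one.\<close>
    define mid where "mid = Node (t1 # hanging F 1 (d - 1) (m - 1))"
    obtain t2 where t2: "real (nodes t2) \<le> real (nodes mid) + K * real h powr c"
      and t2_minor: "\<And>(ch :: nat \<Rightarrow> nat set) sz u v. \<lbrakk>sized_tree d ch sz; descendant ch u v;
        sz u \<le> sz v + h; topo_minor ch v mid\<rbrakk> \<Longrightarrow> topo_minor ch u t2"
      using less.IH[OF h(1,2), of mid] by blast
    have "real (sum_list (map nodes (hanging F 1 (d - 1) (m - 1)))) \<le>
        (\<Sum>i=1..d-1. real ((m - 1) div i) powr c)"
      by (rule nodes_hanging) (use F less.prems False in auto)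
    also have "\<dots> \<le> Z * real (m - 1) powr c" by (rule Z)
    finally have "real (sum_list (map nodes (hanging F 1 (d - 1) (m - 1)))) \<le> Z * real (m - 1) powr c" .
    \<comment> \<open>Passing from \<open>m - 1\<close> to \<open>m\<close> pays for the root of
      \<open>mid\<close>; this is where \<open>Z \<ge> 1\<close> enters.\<close>
    moreover have "1 + Z * real (m - 1) powr c \<le> Z * real m powr c"
    proof -
      have "real (m - 1) powr c + 1 * (real (m - 1) + 1) powr (c - 1) \<le> (real (m - 1) + 1) powr c"
        by (rule powr_add_ge) (use c in auto)
      moreover have "1 \<le> real m powr (c - 1)"
        using False c by (intro ge_one_powr_ge_zero) auto
      ultimately have "real (m - 1) powr c + 1 \<le> real m powr c"
        using False by (simp add: of_nat_diff)
      then have "Z * (real (m - 1) powr c + 1) \<le> Z * real m powr c"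
        using Z(1) by (intro mult_left_mono) auto
      then show ?thesis using Z(1) by (simp add: algebra_simps)
    qed
    moreover have "K * real h powr c \<le> K * ((1/2) powr c * real m powr c)"
    proof -
      have "real h powr c \<le> (1/2 * real m) powr c"
        by (rule powr_mono2) (use c in \<open>auto simp: h_def\<close>)
      also have "\<dots> = (1/2) powr c * real m powr c" by (rule powr_mult)
      finally show ?thesis using K(1) by (rule mult_left_mono)
    qed
    moreover have "(2 * K * (1/2) powr c + Z) * real m powr c \<le> K * real m powr c"
      using K(2) by (rule mult_right_mono) simp
    ultimately have "real (nodes t2) \<le> real (nodes rest) + K * real m powr c"
      using t1 t2 unfolding mid_def by (simp add: algebra_simps)
    moreover have "topo_minor ch u t2" if T: "sized_tree d ch sz" and uv: "descendant ch u v"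
      and sz: "sz u \<le> sz v + m" and v: "topo_minor ch v rest"
      for ch :: "nat \<Rightarrow> nat set" and sz u v
    proof (cases "sz v + h < sz u")
      case False
      \<comment> \<open>Here the whole path loses at most \<open>h\<close>, so the upper spine
        suffices and \<open>v\<close> only has to be found in the first branch of
        \<open>mid\<close>.\<close>
      have "topo_minor ch v mid"
        unfolding mid_def
        by (rule topo_minor.below[of t1]) (use t1_minor[OF T _ _ v, of v] in auto)
      then show ?thesis using t2_minor[OF T uv] False by simp
    next
      case True
      obtain x x' where x: "descendant ch u x" "x' \<in> ch x" "descendant ch x' v"
        "sz u \<le> sz x + h" "sz x' + h < sz u"
        using descendant_crossing[OF T uv True] by blast
      define A where "A = ch x - {x'}"
      have fin: "finite (ch x)" using sized_treeD[OF T] by blast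
      have "sz v \<le> sz x'" "sz x \<le> sz u" using x T descendant_size_le by metis+
      moreover have "sz x = Suc (sz x' + (\<Sum>c\<in>A. sz c))"
        unfolding A_def using sized_treeD(3)[OF T, of x] sum.remove[OF fin x(2), of sz] by simp
      ultimately have "(\<Sum>c\<in>A. sz c) \<le> m - 1" using sz by linarith
      moreover have "finite A" "card A \<le> d - 1"
        unfolding A_def using fin sized_treeD(2)[OF T, of x] x(2) by auto
      moreover have "universal d j (F j)" if "0 < j" "j \<le> m - 1" for j
        using F that less.prems by simp
      ultimately obtain cs where cs: "distinct cs" "set cs = A"
        "length cs \<le> length (hanging F 1 (d - 1) (m - 1))"
        "\<And>i. i < length cs \<Longrightarrow> topo_minor ch (cs ! i) (hanging F 1 (d - 1) (m - 1) ! i)"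
        using children_in_hanging[OF T, of "m - 1" F A "d - 1"] by blast
      \<comment> \<open>More than \<open>h\<close> is lost down to \<open>x'\<close>, and
        \<open>m \<le> 2 * h + 1\<close>, so at most \<open>h\<close> remains between
        \<open>x'\<close> and \<open>v\<close>.\<close>
      have "topo_minor ch x' t1"
        by (rule t1_minor[OF T x(3) _ v]) (use x(5) h sz in linarith)
      then have "topo_minor ch x mid"
        unfolding mid_def using cs x(2)
        by (intro topo_minor.node[of "x' # cs"])
          (auto simp: A_def nth_Cons split: nat.splits)
      then show ?thesis using t2_minor[OF T x(1)] x(4) by blast
    qed
    ultimately show ?thesis by blast
  qed
qed

section \<open>The recursive construction of universal trees\<close>

lemma descendant_with_small_children:
  fixes b :: real
  assumes "sized_tree d ch sz" "b \<le> real (sz u)"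
  shows "\<exists>v. descendant ch u v \<and> b \<le> real (sz v) \<and> (\<forall>c\<in>ch v. real (sz c) < b)"
  using assms(2)
proof (induction "sz u" arbitrary: u rule: less_induct)
  case less
  show ?case
  proof (cases "\<forall>c\<in>ch u. real (sz c) < b")
    case True
    with less.prems show ?thesis by blast
  next
    case False
    \<comment> \<open>The walk descends into a child that is still large; it ends because sizes
      drop.\<close>
    then obtain c where c: "c \<in> ch u" "b \<le> real (sz c)" by (auto simp: not_less)
    with less.hyps[of c] child_size_less[OF assms(1)] obtain v
      where "descendant ch c v" "b \<le> real (sz v)" "\<forall>c\<in>ch v. real (sz c) < b" by blast
    with c show ?thesis by (meson converse_rtranclp_into_rtranclp)
  qed
qed

text \<open>\<open>Z * m powr c\<close> bounds one spine vertex with its hanging trees, \<open>K * m powr c\<close> a whole spine, and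
  \<open>Z' * n powr c\<close> the vertex at the end of the spine with all its hanging trees but the largest.\<close>

lemma universal_exists:
  fixes c K l Z Z' :: real
  assumes c: "c \<ge> 1" and K: "K \<ge> 0" "2 * K * (1/2) powr c + Z \<le> K"
    and Z: "Z \<ge> 1" "\<And>k. (\<Sum>i=1..d-1. real (k div i) powr c) \<le> Z * real k powr c"
    and Z': "\<And>k. 0 < k \<Longrightarrow> 1 + (\<Sum>i=2..d. real (k div i) powr c) \<le> Z' * real (Suc k) powr c"
    and l: "1/2 \<le> l" "l < 1" "l powr c + Z' + K * (1 - l) powr c \<le> 1"
    and d: "d \<ge> 1"
    and n: "n \<ge> 1"
  shows "\<exists>t. universal d n t \<and> real (nodes t) \<le> real n powr c"
  using n
proof (induction n rule: less_induct)
  case (less n)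
  show ?case
  proof (cases "n = 1")
    case True
    have "topo_minor ch v (Node [])" if T: "sized_tree d ch sz" and "sz v \<le> n"
      for ch :: "nat \<Rightarrow> nat set" and sz v
    proof -
      have "ch v = {}" using sized_treeD[OF T] that True
        by (metis One_nat_def Suc_le_mono le_zero_eq not_gr0 sum_eq_0_iff all_not_in_conv)
      then show ?thesis by (intro topo_minor.node[of "[]"]) auto
    qed
    then have "universal d n (Node [])" unfolding universal_def by blast
    then show ?thesis using True by (intro exI[of _ "Node []"]) simp
  next
    case False
    define k where "k = n - 1"
    have k: "n = Suc k" "0 < k" using False less.prems by (auto simp: k_def)
    have "\<forall>j. \<exists>t. 0 < j \<and> j < n \<longrightarrow> universal d j t \<and> real (nodes t) \<le> real j powr c"
      using less.IH by auto
    then obtain F where F: "\<And>j. 0 < j \<Longrightarrow> j < n \<Longrightarrow>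
        universal d j (F j) \<and> real (nodes (F j)) \<le> real j powr c"
      by metis
    \<comment> \<open>\<open>p\<close> bounds the size of trees smaller than \<open>l * n\<close>,
      and \<open>m\<close> the size of what lies outside a subtree of size at least
      \<open>l * n\<close>. As \<open>1/2 \<le> l < 1\<close> and \<open>n \<ge> 2\<close>, one gets
      \<open>0 < p < n\<close>, so \<open>F p\<close> is available.\<close>
    define p where "p = nat \<lfloor>l * real n\<rfloor>"
    define m where "m = nat \<lfloor>(1 - l) * real n\<rfloor>"
    have n2: "real n \<ge> 2" using k by simp
    have "l * real n \<ge> 1/2 * real n" "l * real n < 1 * real n"
      by (intro mult_right_mono mult_strict_right_mono; use l n2 in simp)+
    then have p: "0 < p" "p < n" "real p \<le> l * real n"
      unfolding p_def using n2 by (auto, linarith+)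
    have Fp: "universal d p (F p)" "real (nodes (F p)) \<le> real p powr c"
      using F[OF p(1,2)] by blast+
    have m: "m \<le> n" "real m \<le> (1 - l) * real n"
    proof -
      have "0 \<le> (1 - l) * real n" "(1 - l) * real n \<le> 1 * real n"
        by (intro mult_nonneg_nonneg mult_right_mono; use l in simp)+
      then show "m \<le> n" "real m \<le> (1 - l) * real n" unfolding m_def by linarith+
    qed
    \<comment> \<open>\<open>hs\<close> suits the children of \<open>v\<close>, whose total size is
      at most \<open>k = n - 1\<close>. In \<open>rest\<close> its first entry \<open>F k\<close>
      gives way to \<open>F p\<close>, because every child of \<open>v\<close> is smaller than
      \<open>l * n\<close>.\<close>
    define hs where "hs = hanging F 1 d k"
    define rest where "rest = Node (F p # hanging F 2 d k)"
    have hs_Cons: "hs = F k # hanging F 2 d k"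
      unfolding hs_def hanging_def using k d
      by (subst upt_conv_Cons) (auto simp: numeral_2_eq_2 simp del: upt_Suc)
    obtain t where t: "real (nodes t) \<le> real (nodes rest) + K * real m powr c"
      and t_minor: "\<And>(ch :: nat \<Rightarrow> nat set) sz u v. \<lbrakk>sized_tree d ch sz; descendant ch u v;
        sz u \<le> sz v + m; topo_minor ch v rest\<rbrakk> \<Longrightarrow> topo_minor ch u t"
      using spine[OF F c K Z m(1), of rest] by blast
    have "topo_minor ch u t" if T: "sized_tree d ch sz" and sz: "sz u \<le> n"
      for ch :: "nat \<Rightarrow> nat set" and sz u
    proof (cases "l * real n \<le> real (sz u)")
      case False
      \<comment> \<open>A tree below the threshold fits into \<open>F p\<close>; the path of the
        spine is then the trivial one from \<open>u\<close> to \<open>u\<close>.\<close>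
      then have "sz u \<le> p" unfolding p_def by linarith
      then have "topo_minor ch u (F p)" by (rule universalD[OF Fp(1) T])
      then have "topo_minor ch u rest" unfolding rest_def by (intro topo_minor.below[of "F p"]) auto
      then show ?thesis using t_minor[OF T, of u u] by simp
    next
      case True
      obtain v where v: "descendant ch u v" "l * real n \<le> real (sz v)"
        "\<And>c. c \<in> ch v \<Longrightarrow> real (sz c) < l * real n"
        using descendant_with_small_children[OF T True] by blast
      have "sz v \<le> sz u" using v(1) T descendant_size_le by metis
      then have "(\<Sum>c\<in>ch v. sz c) \<le> k"
        using sized_treeD(3)[OF T, of v] sz k by linarith
      then obtain cs where cs: "distinct cs" "set cs = ch v" "length cs \<le> length hs"
        "\<And>i. i < length cs \<Longrightarrow> topo_minor ch (cs ! i) (hs ! i)"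
        using children_in_hanging[OF T, of k F "ch v" d] F k sized_treeD(1,2)[OF T, of v]
        unfolding hs_def by (metis less_Suc_eq_le)
      have "topo_minor ch (cs ! i) ((F p # hanging F 2 d k) ! i)" if i: "i < length cs" for i
      proof (cases i)
        case 0
        have "real (sz (cs ! i)) < l * real n" by (rule v(3)) (use nth_mem[OF i] cs(2) in simp)
        then have "sz (cs ! i) \<le> p" unfolding p_def by linarith
        then have "topo_minor ch (cs ! i) (F p)" by (rule universalD[OF Fp(1) T])
        then show ?thesis using 0 by simp
      next
        case (Suc j)
        then have "(F p # hanging F 2 d k) ! i = hs ! i" by (simp add: hs_Cons)
        then show ?thesis using cs(4)[OF i] by simp
      qed
      moreover have "length cs \<le> length (F p # hanging F 2 d k)" using cs(3) by (simp add: hs_Cons)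
      ultimately have "topo_minor ch v rest"
        unfolding rest_def using cs(1,2) by (intro topo_minor.node[of cs]) auto
      moreover have "sz u \<le> sz v + m"
      proof -
        have "real (sz u) - real (sz v) \<le> (1 - l) * real n"
          using v(2) sz by (simp add: algebra_simps)
        then show ?thesis unfolding m_def by linarith
      qed
      ultimately show ?thesis using t_minor[OF T v(1)] by blast
    qed
    then have "universal d n t" unfolding universal_def by blast
    moreover have "real (nodes t) \<le> real n powr c"
    proof -
      have "real (sum_list (map nodes (hanging F 2 d k))) \<le> (\<Sum>i=2..d. real (k div i) powr c)"
        by (rule nodes_hanging) (use F k in auto)
      moreover have "1 + (\<Sum>i=2..d. real (k div i) powr c) \<le> Z' * real n powr c"
        using Z'[OF k(2)] k(1) by simp
      moreover have "real (nodes (F p)) \<le> l powr c * real n powr c"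
      proof -
        note Fp(2)
        also have "real p powr c \<le> (l * real n) powr c" by (rule powr_mono2) (use p c in auto)
        finally show ?thesis using l by (simp add: powr_mult)
      qed
      moreover have "K * real m powr c \<le> K * ((1 - l) powr c * real n powr c)"
      proof -
        have "real m powr c \<le> ((1 - l) * real n) powr c" by (rule powr_mono2) (use m c in auto)
        then show ?thesis using K(1) l by (simp add: powr_mult mult_left_mono)
      qed
      moreover have "(l powr c + Z' + K * (1 - l) powr c) * real n powr c \<le> 1 * real n powr c"
        using l(3) by (rule mult_right_mono) simp
      ultimately show ?thesis using t unfolding rest_def by (simp add: algebra_simps)
    qed
    ultimately show ?thesis by blast
  qed
qed

section \<open>The exponents 1.894 and 2.318\<close>

text \<open>Reduces a bound on \<open>x powr (- s)\<close> to integer powers: \<open>m / n\<close> lies slightly above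
  \<open>s\<close>, and \<open>L\<close> bounds \<open>ln x\<close>, so \<open>x powr d\<close> with \<open>d = m / n - s\<close> is at most \<open>1 / (1 - L * d)\<close>.\<close>

lemma powr_neg_le:
  fixes x u q s L d :: real
  assumes x: "x > 0" and q: "q > 0" "n > 0" "1 \<le> q ^ n * x ^ m"
    and L: "x \<le> (1 + L / 16) ^ 16" "L \<ge> 0" "d \<ge> 0" "L * d < 1"
    and u: "q \<le> u * (1 - L * d)" and s: "s = real m / real n - d"
  shows "x powr (- s) \<le> u"
proof -
  have "1 powr (1 / real n) \<le> (q ^ n * x ^ m) powr (1 / real n)"
    using q(3) by (intro powr_mono2) auto
  also have "\<dots> = q * x powr (real m / real n)"
    using x q by (simp add: powr_mult powr_powr flip: powr_realpow)
  finally have 1: "x powr (- (real m / real n)) \<le> q"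
    using x q by (simp add: powr_minus field_simps)
  \<comment> \<open>Since \<open>(1 + L / 16) ^ 16 \<le> exp L\<close>, the hypothesis on
    \<open>x\<close> is a rational certificate for \<open>ln x \<le> L\<close>.\<close>
  have "ln x \<le> ln ((1 + L / 16) ^ 16)" using x L by (subst ln_le_cancel_iff) auto
  also have "\<dots> = 16 * ln (1 + L / 16)" using L by (subst ln_realpow) auto
  also have "\<dots> \<le> 16 * (L / 16)" using L by (intro mult_left_mono ln_add_one_self_le_self) auto
  finally have "d * ln x \<le> d * L" using L by (intro mult_left_mono) auto
  then have "exp (d * ln x) * (1 - L * d) \<le> exp (d * L) * exp (- (d * L))"
    using exp_ge_add_one_self[of "- (d * L)"] L by (intro mult_mono) (auto simp: mult_ac)
  also have "\<dots> = 1" by (simp flip: exp_add)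
  finally have 2: "x powr d * (1 - L * d) \<le> 1" using x by (simp add: powr_def)
  have "x powr (- s) = x powr (- (real m / real n)) * x powr d"
    by (simp add: s flip: powr_add)
  then have "x powr (- s) * (1 - L * d) = x powr (- (real m / real n)) * (x powr d * (1 - L * d))"
    by simp
  also have "\<dots> \<le> q * 1" using 1 2 L q by (intro mult_mono) auto
  also have "\<dots> \<le> u * (1 - L * d)" using u by simp
  finally show ?thesis using L by simp
qed

text \<open>\<open>36/19\<close> exceeds \<open>1.894\<close> by \<open>7/9500\<close>. The bases
  \<open>10/7\<close> and \<open>10/3\<close> are the reciprocals of \<open>l = 7/10\<close> and
  \<open>1 - l\<close>; \<open>3/2\<close> and \<open>5/2\<close> serve the bound \<open>Z'\<close>
  for even \<open>k\<close>.\<close>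

lemma powr_neg_1894:
  "(2::real) powr (- 1.894) \<le> 0.26908" "(10/7::real) powr (- 1.894) \<le> 0.50889"
  "(10/3::real) powr (- 1.894) \<le> 0.10227" "(3/2::real) powr (- 1.894) \<le> 0.5"
  "(5/2::real) powr (- 1.894) \<le> 0.18"
proof -
  show "(2::real) powr (- 1.894) \<le> 0.26908"
    by (rule powr_neg_le[where n = 19 and m = 36 and d = "7/9500" and L = "0.71" and q = "0.26893"])
      (simp_all add: power_divide)
  show "(10/7::real) powr (- 1.894) \<le> 0.50889"
    by (rule powr_neg_le[where n = 19 and m = 36 and d = "7/9500" and L = "0.37" and q = "0.50875"])
      (simp_all add: power_divide)
  show "(10/3::real) powr (- 1.894) \<le> 0.10227"
    by (rule powr_neg_le[where n = 19 and m = 36 and d = "7/9500" and L = "1.26" and q = "0.10217"])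
      (simp_all add: power_divide)
  show "(3/2::real) powr (- 1.894) \<le> 0.5"
    by (rule powr_neg_le[where n = 19 and m = 36 and d = "7/9500" and L = "0.5" and q = "0.48"])
      (simp_all add: power_divide)
  show "(5/2::real) powr (- 1.894) \<le> 0.18"
    by (rule powr_neg_le[where n = 19 and m = 36 and d = "7/9500" and L = 1 and q = "0.177"])
      (simp_all add: power_divide)
qed

text \<open>\<open>51/22\<close> exceeds \<open>2.318\<close> by \<open>1/5500\<close>. The primes
  and \<open>17/2\<close> enter the zeta sum; \<open>50/33\<close> and \<open>50/17\<close> are the
  reciprocals of \<open>l = 33/50\<close> and \<open>1 - l\<close>.\<close>

lemma powr_neg_2318:
  "(2::real) powr (- 2.318) \<le> 0.200547" "(3::real) powr (- 2.318) \<le> 0.078351"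
  "(5::real) powr (- 2.318) \<le> 0.023978" "(7::real) powr (- 2.318) \<le> 0.010993"
  "(17/2::real) powr (- 2.318) \<le> 0.007009" "(50/33::real) powr (- 2.318) \<le> 0.381685"
  "(50/17::real) powr (- 2.318) \<le> 0.082031"
proof -
  note le = powr_neg_le[where n = 22 and m = 51 and d = "1/5500"]
  show "(2::real) powr (- 2.318) \<le> 0.200547"
    by (rule le[where L = "0.71" and q = "0.200521"]) (simp_all add: power_divide)
  show "(3::real) powr (- 2.318) \<le> 0.078351"
    by (rule le[where L = "1.14" and q = "0.078334"]) (simp_all add: power_divide)
  show "(5::real) powr (- 2.318) \<le> 0.023978"
    by (rule le[where L = "1.70" and q = "0.023970"]) (simp_all add: power_divide)
  show "(7::real) powr (- 2.318) \<le> 0.010993"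
    by (rule le[where L = "2.07" and q = "0.010988"]) (simp_all add: power_divide)
  show "(17/2::real) powr (- 2.318) \<le> 0.007009"
    by (rule le[where L = "2.29" and q = "0.007006"]) (simp_all add: power_divide)
  show "(50/33::real) powr (- 2.318) \<le> 0.381685"
    by (rule le[where L = "0.43" and q = "0.381655"]) (simp_all add: power_divide)
  show "(50/17::real) powr (- 2.318) \<le> 0.082031"
    by (rule le[where L = "1.12" and q = "0.082014"]) (simp_all add: power_divide)
qed

section \<open>Comparison of sums of negative powers with integrals\<close>

lemma powr_neg_midpoint_convex:
  fixes x t s :: real
  assumes "s \<ge> 0" "0 \<le> t" "t < x"
  shows "2 * x powr (- s) \<le> (x - t) powr (- s) + (x + t) powr (- s)"
proof -
  have sq: "z powr (- s) = (z powr (- s / 2))\<^sup>2" if "z > 0" for z :: real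
    using that by (simp add: power2_eq_square flip: powr_add)
  \<comment> \<open>\<open>x * x\<close> is replaced by the smaller
    \<open>(x - t) * (x + t)\<close>; then the geometric mean of the two powers is compared with the
    arithmetic mean.\<close>
  have "x powr (- s) = (x * x) powr (- s / 2)"
    using assms by (simp add: powr_mult flip: powr_add)
  also have "\<dots> \<le> ((x - t) * (x + t)) powr (- s / 2)"
  proof (rule powr_mono2')
    show "0 < (x - t) * (x + t)" using assms by simp
    show "(x - t) * (x + t) \<le> x * x" by (simp add: algebra_simps)
  qed (use assms in simp)
  also have "\<dots> = (x - t) powr (- s / 2) * (x + t) powr (- s / 2)"
    using assms by (simp add: powr_mult)
  also have "2 * \<dots> \<le> (x - t) powr (- s) + (x + t) powr (- s)"
    using sum_squares_bound[of "(x - t) powr (- s / 2)" "(x + t) powr (- s / 2)"] assms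
    by (simp add: sq)
  finally show ?thesis by simp
qed

text \<open>The right-hand side is the integral of \<open>t powr (- s)\<close> over
  \<open>[x - 1/2, x + 1/2]\<close>, which the midpoint rule underestimates by convexity. Up to the
  factor \<open>s - 1\<close>, \<open>?h t\<close> is the error on \<open>[x - t, x + t]\<close>; it
  vanishes at \<open>0\<close> and has nonnegative derivative.\<close>

lemma powr_neg_le_integral:
  fixes x s :: real
  assumes s: "s > 1" and x: "x > 1/2"
  shows "x powr (- s) \<le> ((x - 1/2) powr (1 - s) - (x + 1/2) powr (1 - s)) / (s - 1)"
proof -
  let ?h = "\<lambda>t. (x - t) powr (1 - s) - (x + t) powr (1 - s) - 2 * t * (s - 1) * x powr (- s)"
  have "?h 0 \<le> ?h (1/2)"
  proof (rule DERIV_nonneg_imp_nondecreasing[where f = ?h])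
    fix t :: real assume t: "0 \<le> t" "t \<le> 1/2"
    let ?D = "(s - 1) * ((x - t) powr (- s) + (x + t) powr (- s) - 2 * x powr (- s))"
    have "((\<lambda>t. (x - t) powr (1 - s)) has_real_derivative
        (1 - s) * (x - t) powr (1 - s - of_nat 1) * (- 1)) (at t)"
      by (rule DERIV_fun_powr) (use t x in \<open>auto intro!: derivative_eq_intros\<close>)
    moreover have "((\<lambda>t. (x + t) powr (1 - s)) has_real_derivative
        (1 - s) * (x + t) powr (1 - s - of_nat 1) * 1) (at t)"
      by (rule DERIV_fun_powr) (use t x in \<open>auto intro!: derivative_eq_intros\<close>)
    moreover have "((\<lambda>t. 2 * t * (s - 1) * x powr (- s)) has_real_derivative
        2 * (s - 1) * x powr (- s)) (at t)"
      by (auto intro!: derivative_eq_intros)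
    ultimately have "(?h has_real_derivative ?D) (at t)"
      by (rule DERIV_cong[OF DERIV_diff[OF DERIV_diff]]) (simp add: algebra_simps)
    moreover have "?D \<ge> 0"
      using powr_neg_midpoint_convex[of s t x] s t x by (intro mult_nonneg_nonneg) auto
    ultimately show "\<exists>y. (?h has_real_derivative y) (at t) \<and> 0 \<le> y" by blast
  qed simp
  then show ?thesis using s by (simp add: field_simps)
qed

text \<open>The midpoint bounds telescope; the endpoint \<open>N + 1/2\<close> is sharper than
  comparison with the integral from \<open>N\<close>.\<close>

lemma sum_powr_neg_tail:
  fixes s :: real
  assumes s: "s > 1"
  shows "(\<Sum>i=Suc N..M. real i powr (- s)) \<le> (real N + 1/2) powr (1 - s) / (s - 1)"
proof (cases "N \<le> M")
  case True
  then have "(\<Sum>i=Suc N..M. real i powr (- s)) \<le>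
      ((real N + 1/2) powr (1 - s) - (real M + 1/2) powr (1 - s)) / (s - 1)"
  proof (induction M rule: dec_induct)
    case (step M)
    have "real (Suc M) powr (- s) \<le>
        ((real M + 1/2) powr (1 - s) - (real (Suc M) + 1/2) powr (1 - s)) / (s - 1)"
      using powr_neg_le_integral[OF s, of "real (Suc M)"] by (simp add: algebra_simps)
    moreover have "(\<Sum>i=Suc N..Suc M. real i powr (- s)) =
        (\<Sum>i=Suc N..M. real i powr (- s)) + real (Suc M) powr (- s)"
      using step(1) by simp
    ultimately show ?case using step.IH by (simp add: diff_divide_distrib)
  qed simp
  also have "\<dots> \<le> (real N + 1/2) powr (1 - s) / (s - 1)"
    using s by (intro divide_right_mono) auto
  finally show ?thesis .
qed (use s in simp)

text \<open>Eight terms are evaluated, composite indices by multiplicativity, and the rest is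
  bounded by the integral from \<open>17/2\<close>. The bound is uniform in the degree
  \<open>d\<close>.\<close>

lemma zeta_2318: "(\<Sum>i=1..d. real i powr (- 2.318)) \<le> 1.42307"
proof -
  let ?p = "\<lambda>x::real. x powr (- 2.318)"
  have mult: "?p (x * y) \<le> a * b" if "?p x \<le> a" "?p y \<le> b" "x \<ge> 0" "y \<ge> 0" for x y a b :: real
    using that by (simp add: powr_mult mult_mono order_trans[OF powr_ge_zero])
  have composite: "?p 4 \<le> 0.200547 * 0.200547" "?p 6 \<le> 0.200547 * 0.078351"
    "?p 8 \<le> 0.200547 * (0.200547 * 0.200547)"
    using mult[OF powr_neg_2318(1,1)] mult[OF powr_neg_2318(1,2)]
      mult[OF powr_neg_2318(1) mult[OF powr_neg_2318(1,1)]] by simp_all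
  have "(17/2::real) powr (1 - 2.318) = 17/2 * ?p (17/2)"
    using powr_add[of "17/2::real" 1 "- 2.318"] by simp
  also have "\<dots> \<le> 17/2 * 0.007009" using powr_neg_2318(5) by (intro mult_left_mono) auto
  finally have tail: "(17/2::real) powr (1 - 2.318) / (2.318 - 1) \<le> 17/2 * 0.007009 / (2.318 - 1)"
    by (intro divide_right_mono) auto
  have "(\<Sum>i=1..d. ?p (real i)) \<le> (\<Sum>i\<in>{1..8} \<union> {Suc 8..d}. ?p (real i))"
    by (rule sum_mono2) auto
  also have "\<dots> = (\<Sum>i=1..8. ?p (real i)) + (\<Sum>i=Suc 8..d. ?p (real i))"
    by (rule sum.union_disjoint) auto
  also have "(\<Sum>i=1..8. ?p (real i)) = 1 + ?p 2 + ?p 3 + ?p 4 + ?p 5 + ?p 6 + ?p 7 + ?p 8"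
    by (simp add: eval_nat_numeral)
  also have "\<dots> + (\<Sum>i=Suc 8..d. ?p (real i)) \<le> 1.42307"
    using sum_powr_neg_tail[of "2.318" 8 d] tail composite powr_neg_2318(1-4) by simp
  finally show ?thesis .
qed

section \<open>Verification of the parameters for both exponents\<close>

lemma sum_div_powr_le:
  fixes c :: real
  assumes "c \<ge> 0" "a > 0"
  shows "(\<Sum>i=a..d. real (k div i) powr c) \<le> (\<Sum>i=a..d. real i powr (- c)) * real k powr c"
proof -
  have "real (k div i) powr c \<le> real i powr (- c) * real k powr c" if "i \<in> {a..d}" for i
  proof -
    have "real (k div i) powr c \<le> (real k / real i) powr c"
      using assms by (intro powr_mono2 of_nat_div_le_of_nat) auto
    then show ?thesis by (simp add: powr_divide powr_minus divide_simps)
  qed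
  then show ?thesis unfolding sum_distrib_right by (rule sum_mono)
qed

text \<open>In both cases \<open>K\<close> is \<open>Z / (1 - 2 powr (1 - c))\<close> rounded up, and \<open>l\<close> nearly minimises the left-hand
  side of the final inequality.\<close>

lemma universal_binary_exists:
  assumes "n \<ge> 1"
  shows "\<exists>t. universal 2 n t \<and> real (nodes t) \<le> real n powr 1.894"
proof (rule universal_exists[where K = "2.1655" and Z = 1 and Z' = "0.26908" and l = "7/10"])
  have half: "(1/2::real) powr 1.894 \<le> 0.26908"
    using powr_neg_1894(1) by (simp add: powr_minus powr_divide divide_simps)
  then show "2 * 2.1655 * (1/2) powr 1.894 + 1 \<le> (2.1655::real)" by simp
  show "(\<Sum>i=1..2-1. real (k div i) powr 1.894) \<le> 1 * real k powr 1.894" for k by simp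
  have "(7/10::real) powr 1.894 \<le> 0.50889" "(1 - 7/10::real) powr 1.894 \<le> 0.10227"
    using powr_neg_1894(2,3) by (simp_all add: powr_minus powr_divide divide_simps)
  then show "(7/10) powr 1.894 + 0.26908 + 2.1655 * (1 - 7/10) powr 1.894 \<le> (1::real)" by simp
  show "1 + (\<Sum>i=2..2. real (k div i) powr 1.894) \<le> 0.26908 * real (Suc k) powr 1.894"
    if k: "0 < k" for k
  proof -
    define h where "h = real (k div 2)"
    \<comment> \<open>\<open>y\<close> is the gap from \<open>k div 2\<close> to
      \<open>(k + 1) / 2\<close>: \<open>1\<close> for odd \<open>k\<close> and \<open>1/2\<close>
      for even \<open>k\<close>.\<close>
    define y where "y = real (Suc k) / 2 - h"
    have hy: "h + y = real (Suc k) / 2" by (simp add: y_def)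
    have ge: "y * (h + y) powr 0.894 \<le> (h + y) powr 1.894 - h powr 1.894" if "y \<ge> 0"
      using powr_add_ge[of h y "1.894"] that by (simp add: h_def)
    have "1 \<le> (h + y) powr 1.894 - h powr 1.894"
    proof (cases "even k")
      case False
      then have "y = 1" by (auto simp: y_def h_def add_divide_distrib elim!: oddE)
      moreover have "1 \<le> (h + 1) powr 0.894" by (intro ge_one_powr_ge_zero) (auto simp: h_def)
      ultimately show ?thesis using ge by simp
    next
      case True
      then have y: "y = 1/2" by (auto simp: y_def h_def add_divide_distrib elim!: evenE)
      \<comment> \<open>For even \<open>k\<close> the general estimate needs
        \<open>(h + 1/2) powr 0.894 \<ge> 2\<close>, which is available from \<open>h = 2\<close>
        on; \<open>k = 2\<close> is computed directly.\<close>
      show ?thesis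
      proof (cases "k = 2")
        case True
        have "2 \<le> (3/2::real) powr 1.894"
          using powr_neg_1894(4) by (simp add: powr_minus divide_simps)
        then show ?thesis unfolding y using True by (simp add: h_def)
      next
        case False
        then have "h \<ge> 2" using k \<open>even k\<close> by (auto simp: h_def elim!: evenE)
        have "2 * (5/2::real) \<le> (5/2) powr 1.894"
          using powr_neg_1894(5) by (simp add: powr_minus divide_simps)
        also have "\<dots> = 5/2 * (5/2) powr 0.894"
          using powr_add[of "5/2::real" 1 "0.894"] by simp
        finally have "2 \<le> (5/2::real) powr 0.894" by simp
        also have "\<dots> \<le> (h + y) powr 0.894" using \<open>h \<ge> 2\<close> y by (intro powr_mono2) auto
        finally show ?thesis using ge unfolding y by simp
      qed
    qed
    then have "1 + h powr 1.894 \<le> (1/2 * real (Suc k)) powr 1.894" using hy by simp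
    also have "\<dots> = (1/2) powr 1.894 * real (Suc k) powr 1.894" by (rule powr_mult)
    also have "\<dots> \<le> 0.26908 * real (Suc k) powr 1.894" using half by (rule mult_right_mono) simp
    finally show ?thesis by (simp add: h_def)
  qed
qed (use assms in simp_all)

lemma universal_general_exists:
  assumes "n \<ge> 1" "d \<ge> 1"
  shows "\<exists>t. universal d n t \<and> real (nodes t) \<le> real n powr 2.318"
proof (rule universal_exists[where K = "2.3762" and Z = "1.42307" and Z' = "0.42307" and l = "33/50"])
  have half: "(1/2::real) powr 2.318 \<le> 0.200547"
    using powr_neg_2318(1) by (simp add: powr_minus powr_divide divide_simps)
  then show "2 * 2.3762 * (1/2) powr 2.318 + 1.42307 \<le> (2.3762::real)" by simp
  show "(\<Sum>i=1..d-1. real (k div i) powr 2.318) \<le> 1.42307 * real k powr 2.318" for k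
  proof -
    have "(\<Sum>i=1..d-1. real i powr (- 2.318)) * real k powr 2.318 \<le> 1.42307 * real k powr 2.318"
      by (rule mult_right_mono[OF zeta_2318]) simp
    then show ?thesis using sum_div_powr_le[of "2.318" 1 k "d - 1"] by simp
  qed
  have "(33/50::real) powr 2.318 \<le> 0.381685" "(1 - 33/50::real) powr 2.318 \<le> 0.082031"
    using powr_neg_2318(6,7) by (simp_all add: powr_minus powr_divide divide_simps)
  then show "(33/50) powr 2.318 + 0.42307 + 2.3762 * (1 - 33/50) powr 2.318 \<le> (1::real)" by simp
  show "1 + (\<Sum>i=2..d. real (k div i) powr 2.318) \<le> 0.42307 * real (Suc k) powr 2.318"
    if k: "0 < k" for k
  proof -
    have "{1..d} = insert 1 {2..d}" using assms by auto
    then have "(\<Sum>i=2..d. real i powr (- 2.318)) \<le> 0.42307"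
      using zeta_2318[of d] by simp
    then have "(\<Sum>i=2..d. real i powr (- 2.318)) * real k powr 2.318 \<le> 0.42307 * real k powr 2.318"
      by (rule mult_right_mono) simp
    then have "(\<Sum>i=2..d. real (k div i) powr 2.318) \<le> 0.42307 * real k powr 2.318"
      using sum_div_powr_le[of "2.318" 2 k d] by simp
    \<comment> \<open>The value suffices because \<open>2.378 * 0.42307 > 1\<close>, so the growth
      from \<open>k\<close> to \<open>k + 1\<close> covers the extra vertex.\<close>
    moreover have "2.378 \<le> real (Suc k) powr (2.318 - 1)"
    proof -
      have "2 * (2::real) powr (- 2.318) * 2 powr (2.318 - 1) = 1"
        using powr_add[of "2::real" "- 2.318" "2.318 - 1"] by (simp add: powr_minus)
      moreover have "2 * (2::real) powr (- 2.318) * 2 powr (2.318 - 1) \<le>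
          2 * 0.200547 * 2 powr (2.318 - 1)"
        using powr_neg_2318(1) by (intro mult_right_mono) auto
      ultimately have "2.378 \<le> (2::real) powr (2.318 - 1)" by simp
      also have "\<dots> \<le> real (Suc k) powr (2.318 - 1)" using k by (intro powr_mono2) auto
      finally show ?thesis .
    qed
    moreover have "real k powr 2.318 + 1 * (real k + 1) powr (2.318 - 1) \<le> (real k + 1) powr 2.318"
      by (rule powr_add_ge) auto
    ultimately show ?thesis by (simp add: add.commute)
  qed
qed (use assms in simp_all)

theorem theorem1:
  fixes n :: nat
  assumes "n \<ge> 1"
  shows "(\<exists>S :: nat rooted_graph.
            nca_universal_tree S (rooted_trees n :: nat rooted_graph set) \<and>
            real (card (rverts S)) \<le> real n powr 2.318) \<and>
         (\<exists>S :: nat rooted_graph.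
            nca_universal_tree S (rooted_binary_trees n :: nat rooted_graph set) \<and>
            real (card (rverts S)) \<le> real n powr 1.894)"
proof (intro conjI)
  obtain t where t: "universal n n t" "real (nodes t) \<le> real n powr 2.318"
    using universal_general_exists[OF assms assms] by blast
  \<comment> \<open>A tree with \<open>n\<close> vertices has degrees at most \<open>n\<close>, so
    \<open>d = n\<close> covers all of them.\<close>
  have "card (children T v) \<le> n" if "rooted_tree T" "card (rverts T) = n"
    for T :: "nat rooted_graph" and v
  proof -
    have "children T v \<subseteq> rverts T" using children_iff[OF that(1)] by blast
    then show ?thesis using card_mono[OF rooted_treeD(2)[OF that(1)]] that(2) by blast
  qed
  then obtain S :: "nat rooted_graph" where "nca_universal_tree S (rooted_trees n :: nat rooted_graph set)"
    "card (rverts S) \<le> nodes t"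
    using nca_universal_tree_exists[OF t(1), of "rooted_trees n"] unfolding rooted_trees_def by blast
  with t(2) show "\<exists>S :: nat rooted_graph.
      nca_universal_tree S (rooted_trees n :: nat rooted_graph set) \<and>
      real (card (rverts S)) \<le> real n powr 2.318"
    by (intro exI[of _ S]) linarith
next
  obtain t where t: "universal 2 n t" "real (nodes t) \<le> real n powr 1.894"
    using universal_binary_exists[OF assms] by blast
  obtain S :: "nat rooted_graph" where "nca_universal_tree S (rooted_binary_trees n :: nat rooted_graph set)"
    "card (rverts S) \<le> nodes t"
    using nca_universal_tree_exists[OF t(1), of "rooted_binary_trees n"]
    unfolding rooted_binary_trees_def rooted_binary_tree_def by blast
  with t(2) show "\<exists>S :: nat rooted_graph.
      nca_universal_tree S (rooted_binary_trees n :: nat rooted_graph set) \<and>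
      real (card (rverts S)) \<le> real n powr 1.894"
    by (intro exI[of _ S]) linarith
qed

end
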